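(* Let $\Bbbk$ be an algebraically closed field of characteristic zero, $N > 1$ an odd integer, and $q \in \Bbbk$ a primitive $N$-th root of unity. Put $\tilde F = (q-q^{-1})KF \in \overline{U}_q(\mathfrak{sl}_2)$. Suppose that $\alpha,\beta \in \Bbbk$ satisfy $\beta \ne 0$ and $4\alpha = (1-q^2)\beta^2$. Then the right coideal subalgebra $\langle E + \alpha\tilde F + \beta K \rangle$ of $\overline{U}_q(\mathfrak{sl}_2)$ is not semisimple (as an algebra) but has a total integral.
   Context: $\overline{U}_q(\mathfrak{sl}_2)$ is the algebra generated by $K, E, F$ subject to $K^N = 1$, $KE = q^2 EK$, $KF = q^{-2}FK$, $E^N = F^N = 0$, $EF - FE = (K - K^{-1})/(q - q^{-1})$; it is a Hopf algebra with $\Delta(K) = K \otimes K$, $\Delta(E) = E \otimes K + 1 \otimes E$, $\Delta(F) = F \otimes 1 + K^{-1} \otimes F$, $\varepsilon(K)=1$, $\varepsilon(E)=\varepsilon(F)=0$. A right coideal subalgebra of a Hopf algebra $H$ is a (unital) subalgebra $A$ with $\Delta(A) \subset A \otimes H$. A total integral of $A$ is an element $\Lambda \in A$ with $\Lambda a = \varepsilon(a)\Lambda$ for all $a \in A$ and $\varepsilon(\Lambda) \ne 0$. $\langle u \rangle$ denotes the unital subalgebra generated by $u$. *)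

theory Defs
  imports
    "HOL-Library.Poly_Mapping"
    "HOL-Computational_Algebra.Polynomial"
    "HOL-Algebra.QuotRing"
    "HOL-Algebra.Subrings"
    "HOL-Algebra.Algebraic_Closure_Type"
begin

text \<open>
  A \<open>k\<close>-algebra is a \<^typ>\<open>('k, 'a) module\<close> record: a (not necessarily commutative) ring together
  with a scalar multiplication by the elements of the type \<open>'k\<close>. The locale \<^locale>\<open>algebra\<close> of
  the library is restricted to commutative algebras, so only the record is used.
\<close>

definition primitive_root_of_unity :: "nat \<Rightarrow> 'k::field \<Rightarrow> bool" where
  "primitive_root_of_unity n q \<longleftrightarrow> 0 < n \<and> q ^ n = 1 \<and> (\<forall>m. 0 < m \<and> m < n \<longrightarrow> q ^ m \<noteq> 1)"

section \<open>Algebras\<close>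

definition scalar_algebra :: "('k::field, 'k) module" where
  "scalar_algebra = ring.extend ring_of_type_algebra (module.fields (*))"

definition monoid_algebra :: "('a, 'm) monoid_scheme \<Rightarrow> ('k::field, 'a \<Rightarrow>\<^sub>0 'k) module" where
  "monoid_algebra M =
    \<lparr>carrier = {f. Poly_Mapping.keys f \<subseteq> carrier M},
     monoid.mult = (\<lambda>f g. \<Sum>a\<in>Poly_Mapping.keys f. \<Sum>b\<in>Poly_Mapping.keys g.
               Poly_Mapping.single (a \<otimes>\<^bsub>M\<^esub> b) (Poly_Mapping.lookup f a * Poly_Mapping.lookup g b)),
     one = Poly_Mapping.single \<one>\<^bsub>M\<^esub> 1,
     zero = 0,
     add = (+),
     module.smult = (\<lambda>c f. Poly_Mapping.map ((*) c) f)\<rparr>"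

definition free_monoid :: "'g list monoid" where
  "free_monoid = \<lparr>carrier = UNIV, monoid.mult = (@), one = []\<rparr>"

definition free_algebra :: "('k::field, 'g list \<Rightarrow>\<^sub>0 'k) module" where
  "free_algebra = monoid_algebra free_monoid"

definition quot_algebra :: "('k, 'a, 'm) module_scheme \<Rightarrow> 'a set \<Rightarrow> ('k, 'a set) module" where
  "quot_algebra A I = ring.extend (A Quot I)
     (module.fields (\<lambda>c C. \<Union>x\<in>C. I +>\<^bsub>A\<^esub> (c \<odot>\<^bsub>A\<^esub> x)))"

definition presented_algebra :: "('g list \<Rightarrow>\<^sub>0 'k) set \<Rightarrow> ('k::field, ('g list \<Rightarrow>\<^sub>0 'k) set) module" where
  "presented_algebra R = quot_algebra free_algebra (Idl\<^bsub>free_algebra\<^esub> R)"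

definition pres_gen :: "('g list \<Rightarrow>\<^sub>0 'k::field) set \<Rightarrow> 'g \<Rightarrow> ('g list \<Rightarrow>\<^sub>0 'k) set" where
  "pres_gen R x = (Idl\<^bsub>free_algebra\<^esub> R) +>\<^bsub>free_algebra\<^esub> Poly_Mapping.single [x] 1"

definition free_lift ::
    "('k::field, 'b, 'm) module_scheme \<Rightarrow> ('g \<Rightarrow> 'b) \<Rightarrow> ('g list \<Rightarrow>\<^sub>0 'k) \<Rightarrow> 'b" where
  "free_lift B h f =
     (\<Oplus>\<^bsub>B\<^esub>w\<in>Poly_Mapping.keys f. Poly_Mapping.lookup f w \<odot>\<^bsub>B\<^esub> foldr (\<lambda>x y. h x \<otimes>\<^bsub>B\<^esub> y) w \<one>\<^bsub>B\<^esub>)"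

text \<open>
  The algebra homomorphism into \<open>B\<close> that sends each generator \<open>x\<close> of a presented algebra to \<open>h x\<close>.
  It takes the common value of \<^const>\<open>free_lift\<close> on a coset, so it is meaningful when the images
  \<open>h x\<close> satisfy the defining relations.
\<close>

definition pres_lift ::
    "('k::field, 'b, 'm) module_scheme \<Rightarrow> ('g \<Rightarrow> 'b) \<Rightarrow> ('g list \<Rightarrow>\<^sub>0 'k) set \<Rightarrow> 'b" where
  "pres_lift B h C = the_elem (free_lift B h ` C)"

definition is_subalgebra :: "('k, 'a, 'm) module_scheme \<Rightarrow> 'a set \<Rightarrow> bool" where
  "is_subalgebra A S \<longleftrightarrow> subring S A \<and> (\<forall>c. \<forall>x\<in>S. c \<odot>\<^bsub>A\<^esub> x \<in> S)"

definition gen_subalgebra :: "('k, 'a, 'm) module_scheme \<Rightarrow> 'a set \<Rightarrow> 'a set" where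
  "gen_subalgebra A B = \<Inter>{S. is_subalgebra A S \<and> B \<subseteq> S}"

text \<open>
  A ring is semisimple if its left regular module is, i.e. if every submodule of the latter (every
  left ideal) is a direct summand. For unital algebras left ideals are automatically closed under
  scalars.
\<close>

definition is_left_ideal :: "'a set \<Rightarrow> ('a, 'm) ring_scheme \<Rightarrow> bool" where
  "is_left_ideal I R \<longleftrightarrow>
     additive_subgroup I R \<and> (\<forall>a\<in>carrier R. \<forall>x\<in>I. a \<otimes>\<^bsub>R\<^esub> x \<in> I)"

definition semisimple_ring :: "('a, 'm) ring_scheme \<Rightarrow> bool" where
  "semisimple_ring R \<longleftrightarrow>
     (\<forall>I. is_left_ideal I R \<longrightarrow>
        (\<exists>J. is_left_ideal J R \<and> I \<inter> J = {\<zero>\<^bsub>R\<^esub>} \<and> I <+>\<^bsub>R\<^esub> J = carrier R))"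

section \<open>Tensor products\<close>

text \<open>
  The tensor product of two algebras is the vector space with basis all symbols \<open>(a, b)\<close> modulo the
  bilinearity relations. With the multiplication \<open>(a, b) (a', b') = (a a', b b')\<close> on symbols, the
  span of these relations is a two-sided ideal, so that generating an ideal or a subspace by them
  amounts to the same.
\<close>

abbreviation symb :: "'a \<Rightarrow> 'b \<Rightarrow> 'a \<times> 'b \<Rightarrow>\<^sub>0 'k::field" where
  "symb a b \<equiv> Poly_Mapping.single (a, b) 1"

definition bilinear_rels ::
    "('k::field, 'a, 'm) module_scheme \<Rightarrow> ('k, 'b, 'n) module_scheme \<Rightarrow> ('a \<times> 'b \<Rightarrow>\<^sub>0 'k) set" where
  "bilinear_rels A B =
     {symb (x \<oplus>\<^bsub>A\<^esub> y) b - symb x b - symb y b | x y b.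
        x \<in> carrier A \<and> y \<in> carrier A \<and> b \<in> carrier B} \<union>
     {symb a (x \<oplus>\<^bsub>B\<^esub> y) - symb a x - symb a y | a x y.
        a \<in> carrier A \<and> x \<in> carrier B \<and> y \<in> carrier B} \<union>
     {symb (c \<odot>\<^bsub>A\<^esub> a) b - Poly_Mapping.single (a, b) c | c a b.
        a \<in> carrier A \<and> b \<in> carrier B} \<union>
     {symb a (c \<odot>\<^bsub>B\<^esub> b) - Poly_Mapping.single (a, b) c | c a b.
        a \<in> carrier A \<and> b \<in> carrier B}"

definition tensor_ideal ::
    "('k::field, 'a, 'm) module_scheme \<Rightarrow> ('k, 'b, 'n) module_scheme \<Rightarrow> ('a \<times> 'b \<Rightarrow>\<^sub>0 'k) set" where
  "tensor_ideal A B = Idl\<^bsub>monoid_algebra (A \<times>\<times> B)\<^esub> (bilinear_rels A B)"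

definition tensor_algebra ::
    "('k::field, 'a, 'm) module_scheme \<Rightarrow> ('k, 'b, 'n) module_scheme
      \<Rightarrow> ('k, ('a \<times> 'b \<Rightarrow>\<^sub>0 'k) set) module" where
  "tensor_algebra A B = quot_algebra (monoid_algebra (A \<times>\<times> B)) (tensor_ideal A B)"

definition tensor ::
    "('k::field, 'a, 'm) module_scheme \<Rightarrow> ('k, 'b, 'n) module_scheme \<Rightarrow> 'a \<Rightarrow> 'b
      \<Rightarrow> ('a \<times> 'b \<Rightarrow>\<^sub>0 'k) set" where
  "tensor A B a b = tensor_ideal A B +>\<^bsub>monoid_algebra (A \<times>\<times> B)\<^esub> symb a b"

text \<open>The subspace \<open>S \<otimes> T\<close> of \<open>A \<otimes> B\<close>, for subspaces \<open>S\<close> of \<open>A\<close> and \<open>T\<close> of \<open>B\<close>.\<close>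

definition tensor_subspace ::
    "('k::field, 'a, 'm) module_scheme \<Rightarrow> ('k, 'b, 'n) module_scheme \<Rightarrow> 'a set \<Rightarrow> 'b set
      \<Rightarrow> ('a \<times> 'b \<Rightarrow>\<^sub>0 'k) set set" where
  "tensor_subspace A B S T =
     {tensor_ideal A B +>\<^bsub>monoid_algebra (A \<times>\<times> B)\<^esub> f | f. Poly_Mapping.keys f \<subseteq> S \<times> T}"

section \<open>Coideal subalgebras and total integrals\<close>

text \<open>The antipode plays no role for the notions below and is not part of the record.\<close>

record (overloaded) ('k::zero, 'a) hopf = "('k, 'a) module" +
  comult :: "'a \<Rightarrow> ('a \<times> 'a \<Rightarrow>\<^sub>0 'k) set"
  counit :: "'a \<Rightarrow> 'k"

definition right_coideal_subalgebra :: "('k::field, 'a, 'm) hopf_scheme \<Rightarrow> 'a set \<Rightarrow> bool" where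
  "right_coideal_subalgebra H A \<longleftrightarrow>
     is_subalgebra H A \<and> comult H ` A \<subseteq> tensor_subspace H H A (carrier H)"

definition is_total_integral :: "('k::field, 'a, 'm) hopf_scheme \<Rightarrow> 'a set \<Rightarrow> 'a \<Rightarrow> bool" where
  "is_total_integral H A L \<longleftrightarrow>
     L \<in> A \<and> (\<forall>a\<in>A. L \<otimes>\<^bsub>H\<^esub> a = counit H a \<odot>\<^bsub>H\<^esub> L) \<and> counit H L \<noteq> 0"

section \<open>The small quantum group of sl2\<close>

datatype gen = GK | GE | GF

text \<open>Since \<open>K\<^sup>N = 1\<close>, the inverse of \<open>K\<close> is written as the word \<open>K\<^bsup>N-1\<^esup>\<close>.\<close>

definition Uq_rels :: "nat \<Rightarrow> 'k::field \<Rightarrow> (gen list \<Rightarrow>\<^sub>0 'k) set" where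
  "Uq_rels N q =
     {Poly_Mapping.single (replicate N GK) 1 - Poly_Mapping.single [] 1,
      Poly_Mapping.single [GK, GE] 1 - Poly_Mapping.single [GE, GK] (q ^ 2),
      Poly_Mapping.single [GK, GF] 1 - Poly_Mapping.single [GF, GK] (inverse (q ^ 2)),
      Poly_Mapping.single (replicate N GE) 1,
      Poly_Mapping.single (replicate N GF) 1,
      Poly_Mapping.single [GE, GF] 1 - Poly_Mapping.single [GF, GE] 1
        - (Poly_Mapping.single [GK] (1 / (q - inverse q))
           - Poly_Mapping.single (replicate (N - 1) GK) (1 / (q - inverse q)))}"

definition Uq_alg :: "nat \<Rightarrow> 'k::field \<Rightarrow> ('k, (gen list \<Rightarrow>\<^sub>0 'k) set) module" where
  "Uq_alg N q = presented_algebra (Uq_rels N q)"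

definition K\<^sub>q :: "nat \<Rightarrow> 'k::field \<Rightarrow> (gen list \<Rightarrow>\<^sub>0 'k) set" where
  "K\<^sub>q N q = pres_gen (Uq_rels N q) GK"

definition E\<^sub>q :: "nat \<Rightarrow> 'k::field \<Rightarrow> (gen list \<Rightarrow>\<^sub>0 'k) set" where
  "E\<^sub>q N q = pres_gen (Uq_rels N q) GE"

definition F\<^sub>q :: "nat \<Rightarrow> 'k::field \<Rightarrow> (gen list \<Rightarrow>\<^sub>0 'k) set" where
  "F\<^sub>q N q = pres_gen (Uq_rels N q) GF"

definition Uq_comult_gen ::
    "nat \<Rightarrow> 'k::field \<Rightarrow> gen \<Rightarrow> ((gen list \<Rightarrow>\<^sub>0 'k) set \<times> (gen list \<Rightarrow>\<^sub>0 'k) set \<Rightarrow>\<^sub>0 'k) set" where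
  "Uq_comult_gen N q x =
    (let U = Uq_alg N q; T = tensor_algebra U U; t = tensor U U;
         K = K\<^sub>q N q; E = E\<^sub>q N q; F = F\<^sub>q N q; K' = K [^]\<^bsub>U\<^esub> (N - 1)
     in case x of
          GK \<Rightarrow> t K K
        | GE \<Rightarrow> t E K \<oplus>\<^bsub>T\<^esub> t \<one>\<^bsub>U\<^esub> E
        | GF \<Rightarrow> t F \<one>\<^bsub>U\<^esub> \<oplus>\<^bsub>T\<^esub> t K' F)"

definition Uq_counit_gen :: "gen \<Rightarrow> 'k::field" where
  "Uq_counit_gen x = (case x of GK \<Rightarrow> 1 | GE \<Rightarrow> 0 | GF \<Rightarrow> 0)"

definition Uq :: "nat \<Rightarrow> 'k::field \<Rightarrow> ('k, (gen list \<Rightarrow>\<^sub>0 'k) set) hopf" where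
  "Uq N q = module.extend (Uq_alg N q)
     (hopf.fields
        (pres_lift (tensor_algebra (Uq_alg N q) (Uq_alg N q)) (Uq_comult_gen N q))
        (pres_lift scalar_algebra Uq_counit_gen))"

definition Ft\<^sub>q :: "nat \<Rightarrow> 'k::field \<Rightarrow> (gen list \<Rightarrow>\<^sub>0 'k) set" where
  "Ft\<^sub>q N q = (q - inverse q) \<odot>\<^bsub>Uq N q\<^esub> (K\<^sub>q N q \<otimes>\<^bsub>Uq N q\<^esub> F\<^sub>q N q)"

end

theory Submission
  imports Defs
begin

text \<open>
  Put \<open>Q = q\<^sup>2\<close>, \<open>\<sigma> = \<beta>/2\<close> and \<open>u = E + \<alpha> F~ + \<beta> K\<close>, so that \<open>\<alpha> = (1 - Q) \<sigma>\<^sup>2\<close>. The summands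
  \<open>Y = E + \<sigma> K\<close> and \<open>Z = \<alpha> F~ + \<sigma> K\<close> of \<open>u\<close> satisfy \<open>Z Y = Q Y Z + (1 - Q) \<sigma>\<^sup>2\<close>. Hence the \<open>n\<close>-th
  \<open>q\<close>-Hermite polynomial of \<open>u\<close> is the normally ordered sum of the \<open>[n, k]\<^sub>Q Y\<^sup>k Z\<^bsup>n-k\<^esup>\<close>, which for
  \<open>n = N\<close> collapses to \<open>Y\<^sup>N + Z\<^sup>N = 2 \<sigma>\<^sup>N\<close>. The same identity for commuting scalars shows that this
  polynomial relation factors as \<open>(x - \<beta>) W(x)\<^sup>2\<close> with \<open>W(\<beta>) \<noteq> 0\<close> and \<open>deg W = (N - 1)/2\<close>. So \<open>W(u)\<^sup>2\<close>
  is a total integral, whereas \<open>(u - \<beta>) W(u)\<close> has square zero. It is not zero, because \<open>u\<close> acts on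
  a baby Verma module with a cyclic vector, so that \<open>1, u, \<dots>, u\<^bsup>N-1\<^esup>\<close> are linearly independent.
\<close>

section \<open>Associative algebras and monoid algebras\<close>

text \<open>Since \<epsilon>(u) = \<beta>, the counit on \<langle>u\<rangle> is evaluation of
  polynomials at \<beta>. A total integral therefore exists as soon as \<beta> is a simple root of
  the annihilating polynomial of degree N, while a repeated root elsewhere destroys semisimplicity.
  One substitution settles both: at x = \<sigma>(t + 1/t) the q-Hermite polynomial takes the value
  \<sigma>^N (t^N + t^-N), and subtracting its value 2 \<sigma>^N at t = 1 leaves a multiple of (t^N
  - 1)^2. So all other roots are repeated, and W(\<beta>) = \<sigma>^((N-1)/2) N is nonzero in
  characteristic zero. The algebra is a quotient of a free algebra by a generated ideal and might a
  priori be smaller than expected. Identities follow from the relations, but that an element is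
  nonzero has to be seen in a homomorphic image. Counit, comultiplication and representation all
  arise in one way, from three elements satisfying the relations (\<open>Uq_triple\<close>).\<close>

locale kalgebra = ring R for R :: "('k::field, 'a, 'm) module_scheme" (structure) +
  assumes smult_closed [simp, intro]: "x \<in> carrier R \<Longrightarrow> c \<odot> x \<in> carrier R"
    and smult_l_distr: "x \<in> carrier R \<Longrightarrow> (c + d) \<odot> x = c \<odot> x \<oplus> d \<odot> x"
    and smult_r_distr: "\<lbrakk>x \<in> carrier R; y \<in> carrier R\<rbrakk> \<Longrightarrow> c \<odot> (x \<oplus> y) = c \<odot> x \<oplus> c \<odot> y"
    and smult_smult [simp]: "x \<in> carrier R \<Longrightarrow> c \<odot> (d \<odot> x) = (c * d) \<odot> x"
    and smult_one [simp]: "x \<in> carrier R \<Longrightarrow> 1 \<odot> x = x"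
    and smult_mult_left [simp]:
      "\<lbrakk>x \<in> carrier R; y \<in> carrier R\<rbrakk> \<Longrightarrow> (c \<odot> x) \<otimes> y = c \<odot> (x \<otimes> y)"
    and smult_mult_right [simp]:
      "\<lbrakk>x \<in> carrier R; y \<in> carrier R\<rbrakk> \<Longrightarrow> x \<otimes> (c \<odot> y) = c \<odot> (x \<otimes> y)"
begin

lemma smult_zero_left [simp]: "x \<in> carrier R \<Longrightarrow> 0 \<odot> x = \<zero>"
  using smult_l_distr[of x 0 0] by (metis add.l_cancel_one add_0 smult_closed)

lemma smult_zero_right [simp]: "c \<odot> \<zero> = \<zero>"
  using smult_smult[of \<zero> c 0] by simp

lemma smult_minus_one: "x \<in> carrier R \<Longrightarrow> (- 1) \<odot> x = \<ominus> x"
  using smult_l_distr[of x "- 1" 1] by (metis ab_left_minus minus_equality smult_closed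
      smult_one smult_zero_left)

lemma smult_minus_left: "x \<in> carrier R \<Longrightarrow> (- c) \<odot> x = \<ominus> (c \<odot> x)"
  by (metis smult_closed smult_minus_one smult_smult mult_minus1)

lemma minus_eq_smult: "\<lbrakk>x \<in> carrier R; y \<in> carrier R\<rbrakk> \<Longrightarrow> x \<ominus> y = x \<oplus> (- 1) \<odot> y"
  by (simp add: smult_minus_one minus_eq)

lemma smult_pow: "x \<in> carrier R \<Longrightarrow> (c \<odot> x) [^] (n::nat) = c ^ n \<odot> (x [^] n)"
  by (induction n) (simp_all add: mult.commute)

lemma smult_finsum:
  "f \<in> A \<rightarrow> carrier R \<Longrightarrow> c \<odot> finsum R f A = finsum R (\<lambda>i. c \<odot> f i) A"
proof (induction A rule: infinite_finite_induct)
  case (insert x F)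
  then have "f x \<in> carrier R" "f \<in> F \<rightarrow> carrier R" by auto
  moreover from this have "(\<lambda>i. c \<odot> f i) \<in> F \<rightarrow> carrier R" by auto
  ultimately show ?case using insert by (simp add: smult_r_distr finsum_closed)
qed auto

end

lemma kalgebraI:
  fixes R (structure)
  assumes "ring R"
    and "\<And>c x. x \<in> carrier R \<Longrightarrow> c \<odot> x \<in> carrier R"
    and "\<And>c d x. x \<in> carrier R \<Longrightarrow> (c + d) \<odot> x = c \<odot> x \<oplus> d \<odot> x"
    and "\<And>c x y. \<lbrakk>x \<in> carrier R; y \<in> carrier R\<rbrakk> \<Longrightarrow> c \<odot> (x \<oplus> y) = c \<odot> x \<oplus> c \<odot> y"
    and "\<And>c d x. x \<in> carrier R \<Longrightarrow> c \<odot> (d \<odot> x) = (c * d) \<odot> x"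
    and "\<And>x. x \<in> carrier R \<Longrightarrow> 1 \<odot> x = x"
    and "\<And>c x y. \<lbrakk>x \<in> carrier R; y \<in> carrier R\<rbrakk> \<Longrightarrow> (c \<odot> x) \<otimes> y = c \<odot> (x \<otimes> y)"
    and "\<And>c x y. \<lbrakk>x \<in> carrier R; y \<in> carrier R\<rbrakk> \<Longrightarrow> x \<otimes> (c \<odot> y) = c \<odot> (x \<otimes> y)"
  shows "kalgebra R"
  using assms unfolding kalgebra_def kalgebra_axioms_def by auto

text \<open>The ring axioms see only these five fields, so they pass between records that differ in
  further fields, such as a quotient ring and the same ring with scalars attached.\<close>

lemma ring_cong:
  assumes "ring R" "carrier R' = carrier R" "monoid.mult R' = monoid.mult R" "one R' = one R"
    "add R' = add R" "zero R' = zero R"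
  shows "ring R'"
proof -
  interpret ring R by fact
  show ?thesis
    using assms(2-)
    by (intro ringI abelian_groupI monoidI)
       (auto simp: m_assoc l_distr r_distr a_ac intro: l_neg a_inv_closed
         bexI[of _ "a_inv R x" for x])
qed

lemma kalgebra_cong:
  assumes "kalgebra R" "carrier R' = carrier R" "monoid.mult R' = monoid.mult R" "one R' = one R"
    "add R' = add R" "zero R' = zero R" "module.smult R' = module.smult R"
  shows "kalgebra R'"
proof -
  interpret kalgebra R by fact
  show ?thesis
    by (rule kalgebraI, rule ring_cong[OF ring_axioms])
       (auto simp: assms smult_l_distr smult_r_distr)
qed

lemma scalar_algebra_simps [simp]:
  "carrier scalar_algebra = UNIV" "x \<otimes>\<^bsub>scalar_algebra\<^esub> y = x * y" "\<one>\<^bsub>scalar_algebra\<^esub> = 1"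
  "x \<oplus>\<^bsub>scalar_algebra\<^esub> y = x + y" "\<zero>\<^bsub>scalar_algebra\<^esub> = 0" "c \<odot>\<^bsub>scalar_algebra\<^esub> x = c * x"
  by (simp_all add: scalar_algebra_def ring_of_type_algebra_def ring.defs module.defs)

lemma scalar_algebra_pow [simp]: "x [^]\<^bsub>scalar_algebra\<^esub> (n::nat) = x ^ n"
  by (induction n) (simp_all add: nat_pow_def mult.commute)

lemma kalgebra_scalar_algebra: "kalgebra scalar_algebra"
  by (rule kalgebraI, rule ring_cong[OF ring_from_type_algebra])
     (auto simp: algebra_simps fun_eq_iff scalar_algebra_def ring_of_type_algebra_def ring.defs module.defs)

text \<open>Multilinear identities are checked on basis elements by this rule, applied once per
  argument. The support bound \<open>S\<close> is carried along because the monoid laws hold only on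
  a carrier.\<close>

lemma poly_mapping_span_induct [consumes 1, case_names zero single add]:
  fixes f :: "'a \<Rightarrow>\<^sub>0 'b::comm_monoid_add"
  assumes "Poly_Mapping.keys f \<subseteq> S"
    and zero: "P 0"
    and single: "\<And>a c. a \<in> S \<Longrightarrow> P (Poly_Mapping.single a c)"
    and add: "\<And>f g. \<lbrakk>Poly_Mapping.keys f \<subseteq> S; Poly_Mapping.keys g \<subseteq> S; P f; P g\<rbrakk> \<Longrightarrow> P (f + g)"
  shows "P f"
proof -
  let ?g = "\<lambda>A. \<Sum>a\<in>A. Poly_Mapping.single a (Poly_Mapping.lookup f a)"
  have "Poly_Mapping.keys (?g A) \<subseteq> S \<and> P (?g A)" if "finite A" "A \<subseteq> S" for A
    using that
  proof (induction A)
    case (insert x F)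
    then show ?case using keys_add[of "Poly_Mapping.single x (Poly_Mapping.lookup f x)" "?g F"]
      by (auto intro!: add single split: if_splits)
  qed (simp add: zero)
  moreover have "f = ?g (Poly_Mapping.keys f)"
    by (rule poly_mapping_eqI)
       (simp add: lookup_sum lookup_single when_def sum.delta in_keys_iff)
  ultimately show ?thesis using assms(1) by (metis finite_keys)
qed

section \<open>Monoid algebras\<close>

lemma monoid_algebra_simps:
  "carrier (monoid_algebra M) = {f. Poly_Mapping.keys f \<subseteq> carrier M}"
  "\<one>\<^bsub>monoid_algebra M\<^esub> = Poly_Mapping.single \<one>\<^bsub>M\<^esub> 1"
  "\<zero>\<^bsub>monoid_algebra M\<^esub> = 0"
  "f \<oplus>\<^bsub>monoid_algebra M\<^esub> g = f + g"
  "c \<odot>\<^bsub>monoid_algebra M\<^esub> f = Poly_Mapping.map ((*) c) f"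
  by (simp_all add: monoid_algebra_def)

text \<open>Coefficients outside the support vanish, so products with different supports can be
  compared as sums over one index set. Distributivity relies on this, since cancellation can shrink
  the support of a sum.\<close>

lemma monoid_algebra_mult_eq:
  assumes "finite S" "Poly_Mapping.keys f \<subseteq> S" "finite T" "Poly_Mapping.keys g \<subseteq> T"
  shows "f \<otimes>\<^bsub>monoid_algebra M\<^esub> g = (\<Sum>a\<in>S. \<Sum>b\<in>T.
    Poly_Mapping.single (a \<otimes>\<^bsub>M\<^esub> b) (Poly_Mapping.lookup f a * Poly_Mapping.lookup g b))"
proof -
  have "f \<otimes>\<^bsub>monoid_algebra M\<^esub> g = (\<Sum>a\<in>Poly_Mapping.keys f. \<Sum>b\<in>T.
    Poly_Mapping.single (a \<otimes>\<^bsub>M\<^esub> b) (Poly_Mapping.lookup f a * Poly_Mapping.lookup g b))"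
    unfolding monoid_algebra_def monoid.simps using assms
    by (intro sum.cong refl sum.mono_neutral_left) (auto simp: in_keys_iff)
  also have "\<dots> = (\<Sum>a\<in>S. \<Sum>b\<in>T. Poly_Mapping.single (a \<otimes>\<^bsub>M\<^esub> b) (Poly_Mapping.lookup f a * Poly_Mapping.lookup g b))"
    using assms by (intro sum.mono_neutral_left) (auto simp: in_keys_iff)
  finally show ?thesis .
qed

lemma monoid_algebra_mult_single [simp]:
  "Poly_Mapping.single a x \<otimes>\<^bsub>monoid_algebra M\<^esub> Poly_Mapping.single b y
     = Poly_Mapping.single (a \<otimes>\<^bsub>M\<^esub> b) (x * y)"
  by (subst monoid_algebra_mult_eq[where S = "{a}" and T = "{b}"]) auto

lemma monoid_algebra_mult_zero [simp]:
  "0 \<otimes>\<^bsub>monoid_algebra M\<^esub> f = 0" "f \<otimes>\<^bsub>monoid_algebra M\<^esub> 0 = 0"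
  by (simp_all add: monoid_algebra_def)

lemma monoid_algebra_distrib:
  "(f + g) \<otimes>\<^bsub>monoid_algebra M\<^esub> h = f \<otimes>\<^bsub>monoid_algebra M\<^esub> h + g \<otimes>\<^bsub>monoid_algebra M\<^esub> h" (is ?l)
  "h \<otimes>\<^bsub>monoid_algebra M\<^esub> (f + g) = h \<otimes>\<^bsub>monoid_algebra M\<^esub> f + h \<otimes>\<^bsub>monoid_algebra M\<^esub> g" (is ?r)
proof -
  let ?S = "Poly_Mapping.keys f \<union> Poly_Mapping.keys g \<union> Poly_Mapping.keys (f + g)"
  let ?T = "Poly_Mapping.keys h"
  have "u \<otimes>\<^bsub>monoid_algebra M\<^esub> h = (\<Sum>a\<in>?S. \<Sum>b\<in>?T.
      Poly_Mapping.single (a \<otimes>\<^bsub>M\<^esub> b) (Poly_Mapping.lookup u a * Poly_Mapping.lookup h b))" if "u \<in> {f, g, f + g}" for u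
    using that by (intro monoid_algebra_mult_eq) auto
  then show ?l
    by (simp add: lookup_add distrib_right single_add sum.distrib)
  have "h \<otimes>\<^bsub>monoid_algebra M\<^esub> u = (\<Sum>a\<in>?T. \<Sum>b\<in>?S.
      Poly_Mapping.single (a \<otimes>\<^bsub>M\<^esub> b) (Poly_Mapping.lookup h a * Poly_Mapping.lookup u b))" if "u \<in> {f, g, f + g}" for u
    using that by (intro monoid_algebra_mult_eq) auto
  then show ?r
    by (simp add: lookup_add distrib_left single_add sum.distrib)
qed

lemma lookup_map_times [simp]:
  "Poly_Mapping.lookup (Poly_Mapping.map ((*) c) f) a = c * Poly_Mapping.lookup (f :: 'a \<Rightarrow>\<^sub>0 'k::field) a"
  by (simp add: Poly_Mapping.map.rep_eq when_def)

lemma map_times_simps: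
  fixes f g :: "'a \<Rightarrow>\<^sub>0 'k::field"
  shows "Poly_Mapping.map ((*) c) (f + g) = Poly_Mapping.map ((*) c) f + Poly_Mapping.map ((*) c) g"
    "Poly_Mapping.map ((*) c) (0 :: 'a \<Rightarrow>\<^sub>0 'k) = 0"
    "Poly_Mapping.map ((*) c) (Poly_Mapping.single a x) = Poly_Mapping.single a (c * x)"
  by (auto intro!: poly_mapping_eqI simp: lookup_add algebra_simps lookup_single when_def)

text \<open>\<open>S\<close> is any multiplicatively closed set because this serves both for the
  whole carrier and for a product of two subalgebras inside a tensor product.\<close>

lemma keys_monoid_algebra_mult:
  assumes S: "\<And>a b. \<lbrakk>a \<in> S; b \<in> S\<rbrakk> \<Longrightarrow> a \<otimes>\<^bsub>M\<^esub> b \<in> S"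
    and f: "Poly_Mapping.keys f \<subseteq> S" and g: "Poly_Mapping.keys g \<subseteq> S"
  shows "Poly_Mapping.keys (f \<otimes>\<^bsub>monoid_algebra M\<^esub> g) \<subseteq> S"
  using f
proof (induction rule: poly_mapping_span_induct)
  case (single a c)
  show ?case using g
  proof (induction rule: poly_mapping_span_induct)
    case (add f g)
    then show ?case
      by (metis (no_types, lifting) Un_least dual_order.trans keys_add monoid_algebra_distrib(2))
  qed (use single S in auto)
next
  case (add f g)
  then show ?case
    by (metis (no_types, lifting) Un_least dual_order.trans keys_add monoid_algebra_distrib(1))
qed auto

lemma monoid_algebra_mult_assoc:
  assumes "Group.monoid M" and f: "Poly_Mapping.keys f \<subseteq> carrier M"
    and g: "Poly_Mapping.keys g \<subseteq> carrier M" and h: "Poly_Mapping.keys h \<subseteq> carrier M"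
  shows "(f \<otimes>\<^bsub>monoid_algebra M\<^esub> g) \<otimes>\<^bsub>monoid_algebra M\<^esub> h = f \<otimes>\<^bsub>monoid_algebra M\<^esub> (g \<otimes>\<^bsub>monoid_algebra M\<^esub> h)"
proof -
  interpret Group.monoid M by fact
  show ?thesis using f
  proof (induction rule: poly_mapping_span_induct)
    case (single a c)
    note a = single
    show ?case using g
    proof (induction rule: poly_mapping_span_induct)
      case (single b d)
      note b = single
      show ?case using h
      proof (induction rule: poly_mapping_span_induct)
        case (single e x)
        with a b show ?case by (simp add: m_assoc mult.assoc)
      qed (auto simp: monoid_algebra_distrib)
    qed (auto simp: monoid_algebra_distrib)
  qed (auto simp: monoid_algebra_distrib)
qed

lemma monoid_algebra_one_mult:
  assumes "Group.monoid M" "Poly_Mapping.keys f \<subseteq> carrier M"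
  shows "Poly_Mapping.single \<one>\<^bsub>M\<^esub> 1 \<otimes>\<^bsub>monoid_algebra M\<^esub> f = f"
    "f \<otimes>\<^bsub>monoid_algebra M\<^esub> Poly_Mapping.single \<one>\<^bsub>M\<^esub> 1 = f"
proof -
  interpret Group.monoid M by fact
  show "Poly_Mapping.single \<one>\<^bsub>M\<^esub> 1 \<otimes>\<^bsub>monoid_algebra M\<^esub> f = f"
    using assms(2) by (induction rule: poly_mapping_span_induct) (auto simp: monoid_algebra_distrib)
  show "f \<otimes>\<^bsub>monoid_algebra M\<^esub> Poly_Mapping.single \<one>\<^bsub>M\<^esub> 1 = f"
    using assms(2) by (induction rule: poly_mapping_span_induct) (auto simp: monoid_algebra_distrib)
qed

lemma keys_map_times: "Poly_Mapping.keys (Poly_Mapping.map ((*) c) f) \<subseteq> Poly_Mapping.keys (f :: 'a \<Rightarrow>\<^sub>0 'k::field)"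
  by (auto simp: in_keys_iff)

lemma kalgebra_monoid_algebra:
  assumes "Group.monoid M"
  shows "kalgebra (monoid_algebra M :: ('k::field, _) module)"
proof -
  interpret M: Group.monoid M by fact
  let ?A = "monoid_algebra M :: ('k::field, _) module"
  have mult_closed: "Poly_Mapping.keys (f \<otimes>\<^bsub>?A\<^esub> g) \<subseteq> carrier M"
    if "Poly_Mapping.keys f \<subseteq> carrier M" "Poly_Mapping.keys g \<subseteq> carrier M" for f g
    using that by (intro keys_monoid_algebra_mult) auto
  have "ring ?A"
  proof (rule ringI)
    show "abelian_group ?A"
    proof (rule abelian_groupI)
      fix x y assume "x \<in> carrier ?A" "y \<in> carrier ?A"
      then show "x \<oplus>\<^bsub>?A\<^esub> y \<in> carrier ?A"
        using keys_add[of x y] by (auto simp: monoid_algebra_simps)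
    next
      fix x assume x: "x \<in> carrier ?A"
      show "\<exists>y\<in>carrier ?A. y \<oplus>\<^bsub>?A\<^esub> x = \<zero>\<^bsub>?A\<^esub>"
        by (rule bexI[of _ "- x"]) (use x in \<open>auto simp: monoid_algebra_simps in_keys_iff\<close>)
    qed (auto simp: monoid_algebra_simps algebra_simps)
    show "Group.monoid ?A"
      by (rule monoidI)
         (auto simp: monoid_algebra_simps mult_closed[THEN subsetD]
          monoid_algebra_mult_assoc[OF assms] monoid_algebra_one_mult[OF assms])
  qed (auto simp: monoid_algebra_simps monoid_algebra_distrib)
  moreover have "Poly_Mapping.map ((*) c) f \<otimes>\<^bsub>?A\<^esub> g = Poly_Mapping.map ((*) c) (f \<otimes>\<^bsub>?A\<^esub> g)"
    for f g c
  proof (rule poly_mapping_span_induct[of f UNIV])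
    fix a x
    show "Poly_Mapping.map ((*) c) (Poly_Mapping.single a x) \<otimes>\<^bsub>?A\<^esub> g
        = Poly_Mapping.map ((*) c) (Poly_Mapping.single a x \<otimes>\<^bsub>?A\<^esub> g)"
      by (rule poly_mapping_span_induct[of g UNIV])
         (auto simp: map_times_simps monoid_algebra_distrib mult.assoc)
  qed (auto simp: map_times_simps monoid_algebra_distrib)
  moreover have "f \<otimes>\<^bsub>?A\<^esub> Poly_Mapping.map ((*) c) g = Poly_Mapping.map ((*) c) (f \<otimes>\<^bsub>?A\<^esub> g)"
    for f g c
  proof (rule poly_mapping_span_induct[of f UNIV])
    fix a x
    show "Poly_Mapping.single a x \<otimes>\<^bsub>?A\<^esub> Poly_Mapping.map ((*) c) g
        = Poly_Mapping.map ((*) c) (Poly_Mapping.single a x \<otimes>\<^bsub>?A\<^esub> g)"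
      by (rule poly_mapping_span_induct[of g UNIV])
         (auto simp: map_times_simps monoid_algebra_distrib mult.left_commute)
  qed (auto simp: map_times_simps monoid_algebra_distrib)
  ultimately show ?thesis
    by (intro kalgebraI)
       (auto simp: monoid_algebra_simps map_times_simps lookup_add algebra_simps in_keys_iff
         intro!: poly_mapping_eqI)
qed

section \<open>Homomorphisms, quotients and presentations\<close>

locale kalgebra_hom = A: kalgebra A + B: kalgebra B
  for A :: "('k::field, 'a, 'm) module_scheme" and B :: "('k, 'b, 'n) module_scheme" +
  fixes f :: "'a \<Rightarrow> 'b"
  assumes closed [simp, intro]: "x \<in> carrier A \<Longrightarrow> f x \<in> carrier B"
    and add [simp]: "\<lbrakk>x \<in> carrier A; y \<in> carrier A\<rbrakk> \<Longrightarrow> f (x \<oplus>\<^bsub>A\<^esub> y) = f x \<oplus>\<^bsub>B\<^esub> f y"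
    and mult [simp]: "\<lbrakk>x \<in> carrier A; y \<in> carrier A\<rbrakk> \<Longrightarrow> f (x \<otimes>\<^bsub>A\<^esub> y) = f x \<otimes>\<^bsub>B\<^esub> f y"
    and one [simp]: "f \<one>\<^bsub>A\<^esub> = \<one>\<^bsub>B\<^esub>"
    and smult [simp]: "x \<in> carrier A \<Longrightarrow> f (c \<odot>\<^bsub>A\<^esub> x) = c \<odot>\<^bsub>B\<^esub> f x"
begin

lemma ring_hom: "ring_hom_ring A B f"
  by (intro ring_hom_ringI A.ring_axioms B.ring_axioms) auto

lemma zero [simp]: "f \<zero>\<^bsub>A\<^esub> = \<zero>\<^bsub>B\<^esub>"
  using smult[of "\<zero>\<^bsub>A\<^esub>" 0] by simp

lemma minus [simp]: "\<lbrakk>x \<in> carrier A; y \<in> carrier A\<rbrakk> \<Longrightarrow> f (x \<ominus>\<^bsub>A\<^esub> y) = f x \<ominus>\<^bsub>B\<^esub> f y"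
  by (simp add: A.minus_eq_smult B.minus_eq_smult)

lemma genideal_kernel:
  assumes "R \<subseteq> carrier A" "\<And>r. r \<in> R \<Longrightarrow> f r = \<zero>\<^bsub>B\<^esub>" "x \<in> Idl\<^bsub>A\<^esub> R"
  shows "f x = \<zero>\<^bsub>B\<^esub>"
proof -
  have "ideal (a_kernel A B f) A"
    by (rule ring_hom_ring.kernel_is_ideal[OF ring_hom])
  moreover have "R \<subseteq> a_kernel A B f"
    using assms(1,2) unfolding a_kernel_def' by blast
  ultimately have "Idl\<^bsub>A\<^esub> R \<subseteq> a_kernel A B f"
    by (rule A.genideal_minimal)
  with assms(3) show ?thesis unfolding a_kernel_def' by blast
qed

end

text \<open>A scalar acts as multiplication by a multiple of \<one>, so ring ideals are subspaces
  and the quotients by them are again algebras.\<close>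

lemma (in kalgebra) ideal_smult_closed:
  assumes "ideal I R" "x \<in> I"
  shows "c \<odot> x \<in> I"
proof -
  interpret ideal I R by fact
  have "x \<in> carrier R" using assms(2) by (rule a_Hcarr)
  then show ?thesis
    using I_l_closed[OF assms(2), of "c \<odot> \<one>"] by simp
qed

section \<open>Quotients by two-sided ideals\<close>

lemma quot_algebra_simps:
  "carrier (quot_algebra A I) = (\<lambda>x. I +>\<^bsub>A\<^esub> x) ` carrier A"
  "\<one>\<^bsub>quot_algebra A I\<^esub> = I +>\<^bsub>A\<^esub> \<one>\<^bsub>A\<^esub>"
  "\<zero>\<^bsub>quot_algebra A I\<^esub> = I"
  by (auto simp: quot_algebra_def ring.defs module.defs FactRing_def A_RCOSETS_defs
      a_r_coset_def r_coset_def)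

lemma
  assumes "kalgebra A" "ideal I A"
  shows kalgebra_quot_algebra: "kalgebra (quot_algebra A I)"
    and kalgebra_hom_rcos: "kalgebra_hom A (quot_algebra A I) (\<lambda>x. I +>\<^bsub>A\<^esub> x)"
proof -
  interpret A: kalgebra A by fact
  interpret I: ideal I A by fact
  let ?Q = "quot_algebra A I"
  let ?p = "\<lambda>x. I +>\<^bsub>A\<^esub> x"
  have Q: "ring ?Q"
    by (rule ring_cong[OF I.quotient_is_ring])
       (simp_all add: quot_algebra_def ring.defs module.defs)
  have add: "?p x \<oplus>\<^bsub>?Q\<^esub> ?p y = ?p (x \<oplus>\<^bsub>A\<^esub> y)" if "x \<in> carrier A" "y \<in> carrier A" for x y
    using that by (simp add: quot_algebra_def ring.defs module.defs FactRing_def I.a_rcos_sum)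
  have mult: "?p x \<otimes>\<^bsub>?Q\<^esub> ?p y = ?p (x \<otimes>\<^bsub>A\<^esub> y)" if "x \<in> carrier A" "y \<in> carrier A" for x y
    using that by (simp add: quot_algebra_def ring.defs module.defs FactRing_def I.rcoset_mult_add)
  have smult: "c \<odot>\<^bsub>?Q\<^esub> ?p x = ?p (c \<odot>\<^bsub>A\<^esub> x)" if x: "x \<in> carrier A" for c x
  proof -
    \<comment> \<open>Scaling a coset is defined as a union over its representatives; the union
      collapses because they all give the same coset.\<close>
    have "?p (c \<odot>\<^bsub>A\<^esub> y) = ?p (c \<odot>\<^bsub>A\<^esub> x)" if "y \<in> ?p x" for y
    proof -
      from that obtain i where i: "i \<in> I" "y = i \<oplus>\<^bsub>A\<^esub> x"
        by (auto simp: a_r_coset_def r_coset_def)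
      then have "i \<in> carrier A" by auto
      moreover have "c \<odot>\<^bsub>A\<^esub> i \<in> I" using A.ideal_smult_closed[OF assms(2) i(1)] .
      ultimately have "c \<odot>\<^bsub>A\<^esub> y \<in> ?p (c \<odot>\<^bsub>A\<^esub> x)"
        using x i by (auto simp: a_r_coset_def r_coset_def A.smult_r_distr)
      then show ?thesis using x I.a_repr_independence'[of "c \<odot>\<^bsub>A\<^esub> y" "c \<odot>\<^bsub>A\<^esub> x"] by auto
    qed
    moreover have "x \<in> ?p x" using x by (rule I.a_rcos_self)
    ultimately have "(\<Union>y\<in>?p x. ?p (c \<odot>\<^bsub>A\<^esub> y)) = ?p (c \<odot>\<^bsub>A\<^esub> x)" by blast
    then show ?thesis by (simp add: quot_algebra_def ring.defs module.defs)
  qed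
  show *: "kalgebra ?Q"
    by (rule kalgebraI[OF Q])
       (auto simp: quot_algebra_simps(1) add mult smult A.smult_l_distr A.smult_r_distr)
  show "kalgebra_hom A ?Q ?p"
    by (intro kalgebra_hom.intro kalgebra_hom_axioms.intro * A.kalgebra_axioms)
       (auto simp: quot_algebra_simps(1,2) add mult smult)
qed

lemma rcos_eq_zero:
  assumes "kalgebra A" "ideal I A" "x \<in> I"
  shows "I +>\<^bsub>A\<^esub> x = \<zero>\<^bsub>quot_algebra A I\<^esub>"
proof -
  interpret kalgebra A by fact
  interpret ideal I A by fact
  show ?thesis using assms(3) by (simp add: quot_algebra_simps a_rcos_const)
qed

lemma (in kalgebra) eq_of_minus_eq_zero:
  "\<lbrakk>x \<in> carrier R; y \<in> carrier R; x \<ominus> y = \<zero>\<rbrakk> \<Longrightarrow> x = y"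
  by (rule r_right_minus_eq[THEN iffD1])

lemma rcos_eqI:
  assumes "kalgebra A" "ideal I A" "x \<in> carrier A" "y \<in> carrier A" "x \<ominus>\<^bsub>A\<^esub> y \<in> I"
  shows "I +>\<^bsub>A\<^esub> x = I +>\<^bsub>A\<^esub> y"
proof -
  interpret kalgebra_hom A "quot_algebra A I" "\<lambda>x. I +>\<^bsub>A\<^esub> x"
    by (rule kalgebra_hom_rcos) fact+
  show ?thesis
    by (rule B.eq_of_minus_eq_zero[OF closed[OF assms(3)] closed[OF assms(4)]])
       (simp only: minus[OF assms(3,4), symmetric] rcos_eq_zero[OF assms(1,2,5)])
qed

text \<open>A homomorphism that kills \<open>I\<close> is constant on cosets; this is what gives
  \<open>the_elem\<close> in \<open>pres_lift\<close> its meaning.\<close>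

lemma (in kalgebra_hom) image_rcos:
  assumes "ideal I A" "\<And>y. y \<in> I \<Longrightarrow> f y = \<zero>\<^bsub>B\<^esub>" "x \<in> carrier A"
  shows "f ` (I +>\<^bsub>A\<^esub> x) = {f x}"
proof -
  interpret ideal I A by fact
  show ?thesis
    using a_rcos_self[OF assms(3)] assms
    by (auto simp: a_r_coset_def r_coset_def a_Hcarr)
qed

lemma (in kalgebra_hom) kalgebra_hom_quot:
  assumes "ideal I A" "\<And>y. y \<in> I \<Longrightarrow> f y = \<zero>\<^bsub>B\<^esub>"
  shows "kalgebra_hom (quot_algebra A I) B (\<lambda>C. the_elem (f ` C))"
proof -
  let ?Q = "quot_algebra A I"
  interpret Q: kalgebra_hom A "quot_algebra A I" "\<lambda>x. I +>\<^bsub>A\<^esub> x"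
    by (rule kalgebra_hom_rcos[OF A.kalgebra_axioms assms(1)])
  show ?thesis
  proof (intro kalgebra_hom.intro kalgebra_hom_axioms.intro Q.B.kalgebra_axioms B.kalgebra_axioms)
    fix C D c
    assume "C \<in> carrier (quot_algebra A I)" "D \<in> carrier (quot_algebra A I)"
    then obtain x y where x: "x \<in> carrier A" "C = I +>\<^bsub>A\<^esub> x" and y: "y \<in> carrier A" "D = I +>\<^bsub>A\<^esub> y"
      by (auto simp: quot_algebra_simps(1))
    show "the_elem (f ` C) \<in> carrier B"
      using x by (simp add: image_rcos[OF assms])
    show "the_elem (f ` (C \<oplus>\<^bsub>?Q\<^esub> D)) = the_elem (f ` C) \<oplus>\<^bsub>B\<^esub> the_elem (f ` D)"
      using x y Q.add[of x y, symmetric] by (simp add: image_rcos[OF assms] del: Q.add)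
    show "the_elem (f ` (C \<otimes>\<^bsub>?Q\<^esub> D)) = the_elem (f ` C) \<otimes>\<^bsub>B\<^esub> the_elem (f ` D)"
      using x y Q.mult[of x y, symmetric] by (simp add: image_rcos[OF assms] del: Q.mult)
    show "the_elem (f ` (c \<odot>\<^bsub>?Q\<^esub> C)) = c \<odot>\<^bsub>B\<^esub> the_elem (f ` C)"
      using x Q.smult[of x c, symmetric] by (simp add: image_rcos[OF assms] del: Q.smult)
  next
    show "the_elem (f ` \<one>\<^bsub>?Q\<^esub>) = \<one>\<^bsub>B\<^esub>"
      by (simp add: quot_algebra_simps(2) image_rcos[OF assms] del: Q.one)
  qed
qed

section \<open>The free algebra and its universal property\<close>

lemma monoid_free_monoid: "Group.monoid free_monoid"
  by (rule monoidI) (auto simp: free_monoid_def)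

lemma kalgebra_free_algebra: "kalgebra free_algebra"
  unfolding free_algebra_def by (rule kalgebra_monoid_algebra[OF monoid_free_monoid])

lemma free_algebra_simps [simp]:
  "carrier free_algebra = UNIV" "\<one>\<^bsub>free_algebra\<^esub> = Poly_Mapping.single [] 1"
  "\<zero>\<^bsub>free_algebra\<^esub> = 0" "f \<oplus>\<^bsub>free_algebra\<^esub> g = f + g"
  "c \<odot>\<^bsub>free_algebra\<^esub> f = Poly_Mapping.map ((*) c) f"
  "Poly_Mapping.single v x \<otimes>\<^bsub>free_algebra\<^esub> Poly_Mapping.single w y = Poly_Mapping.single (v @ w) (x * y)"
  by (simp_all add: free_algebra_def monoid_algebra_simps free_monoid_def)

lemma free_algebra_mult_distrib:
  "(f + g) \<otimes>\<^bsub>free_algebra\<^esub> h = f \<otimes>\<^bsub>free_algebra\<^esub> h + g \<otimes>\<^bsub>free_algebra\<^esub> h"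
  "h \<otimes>\<^bsub>free_algebra\<^esub> (f + g) = h \<otimes>\<^bsub>free_algebra\<^esub> f + h \<otimes>\<^bsub>free_algebra\<^esub> g"
  by (simp_all add: free_algebra_def monoid_algebra_distrib)

lemma free_algebra_mult_zero [simp]:
  "0 \<otimes>\<^bsub>free_algebra\<^esub> h = 0" "h \<otimes>\<^bsub>free_algebra\<^esub> 0 = 0"
  by (simp_all add: free_algebra_def)

lemma kalgebra_minus_eq:
  assumes "kalgebra (monoid_algebra M :: ('k::field, _) module)"
    and "f \<in> carrier (monoid_algebra M :: ('k, _) module)" "g \<in> carrier (monoid_algebra M :: ('k, _) module)"
  shows "f \<ominus>\<^bsub>monoid_algebra M\<^esub> g = f - g"
proof -
  interpret kalgebra "monoid_algebra M :: ('k, _) module" by fact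
  show ?thesis using assms(2,3)
    by (auto simp: minus_eq_smult monoid_algebra_simps lookup_add lookup_minus intro!: poly_mapping_eqI)
qed

lemma free_algebra_minus_eq [simp]: "f \<ominus>\<^bsub>free_algebra\<^esub> g = f - (g :: 'g list \<Rightarrow>\<^sub>0 'k::field)"
  using kalgebra_minus_eq[OF kalgebra_monoid_algebra[OF monoid_free_monoid], of f g]
  by (simp add: free_algebra_def[symmetric])

context
  fixes B :: "('k::field, 'b, 'n) module_scheme" (structure) and h :: "'g \<Rightarrow> 'b"
  assumes B: "kalgebra B" and h: "\<And>x. h x \<in> carrier B"
begin

interpretation kalgebra B by (rule B)

private abbreviation "word_val w \<equiv> foldr (\<lambda>x y. h x \<otimes> y) w \<one>"

lemma word_val_closed [simp]: "word_val w \<in> carrier B"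
  by (induction w) (auto simp: h)

lemma word_val_append: "word_val (v @ w) = word_val v \<otimes> word_val w"
  by (induction v) (auto simp: h m_assoc)

lemma free_lift_superset:
  assumes "finite S" "Poly_Mapping.keys f \<subseteq> S"
  shows "free_lift B h f = (\<Oplus>w\<in>S. Poly_Mapping.lookup f w \<odot> word_val w)"
  unfolding free_lift_def using assms
  by (intro add.finprod_mono_neutral_cong_left) (auto simp: in_keys_iff)

lemma free_lift_closed: "free_lift B h f \<in> carrier B"
  unfolding free_lift_def by (rule finsum_closed) auto

lemma free_lift_zero: "free_lift B h 0 = \<zero>"
  by (simp add: free_lift_def)

lemma free_lift_add: "free_lift B h (f + g) = free_lift B h f \<oplus> free_lift B h g"
proof -
  let ?S = "Poly_Mapping.keys f \<union> Poly_Mapping.keys g \<union> Poly_Mapping.keys (f + g)"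
  have "free_lift B h u = (\<Oplus>w\<in>?S. Poly_Mapping.lookup u w \<odot> word_val w)" if "u \<in> {f, g, f + g}" for u
    using that by (intro free_lift_superset) auto
  then show ?thesis
    by (simp add: lookup_add smult_l_distr finsum_addf)
qed

lemma free_lift_single: "free_lift B h (Poly_Mapping.single w c) = c \<odot> word_val w"
  by (subst free_lift_superset[of "{w}"]) auto

lemma free_lift_smult: "free_lift B h (Poly_Mapping.map ((*) c) f) = c \<odot> free_lift B h f"
  by (rule poly_mapping_span_induct[of f UNIV])
     (auto simp: map_times_simps free_lift_zero free_lift_add free_lift_single smult_r_distr
       free_lift_closed)

lemma free_lift_mult: "free_lift B h (f \<otimes>\<^bsub>free_algebra\<^esub> g) = free_lift B h f \<otimes> free_lift B h g"
proof (rule poly_mapping_span_induct[of f UNIV])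
  fix a x
  show "free_lift B h (Poly_Mapping.single a x \<otimes>\<^bsub>free_algebra\<^esub> g)
      = free_lift B h (Poly_Mapping.single a x) \<otimes> free_lift B h g"
    by (rule poly_mapping_span_induct[of g UNIV])
       (auto simp del: foldr_append simp: free_lift_zero free_lift_add free_lift_single r_distr word_val_append
         free_algebra_mult_distrib free_lift_closed mult.commute)
qed (auto simp: free_lift_zero free_lift_add l_distr free_algebra_mult_distrib free_lift_closed)

lemma kalgebra_hom_free_lift: "kalgebra_hom free_algebra B (free_lift B h)"
  by (intro kalgebra_hom.intro kalgebra_hom_axioms.intro kalgebra_free_algebra B)
     (auto simp: free_lift_closed free_lift_add free_lift_mult free_lift_single free_lift_smult)

lemma ideal_genideal_free: "ideal (Idl\<^bsub>free_algebra\<^esub> R) (free_algebra :: ('k, 'g list \<Rightarrow>\<^sub>0 'k) module)"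
proof -
  interpret F: kalgebra "free_algebra :: ('k, 'g list \<Rightarrow>\<^sub>0 'k) module" by (rule kalgebra_free_algebra)
  show ?thesis by (rule F.genideal_ideal) simp
qed

context
  fixes R :: "('g list \<Rightarrow>\<^sub>0 'k) set"
  assumes R: "\<And>r. r \<in> R \<Longrightarrow> free_lift B h r = \<zero>"
begin

interpretation F: kalgebra_hom free_algebra B "free_lift B h" by (rule kalgebra_hom_free_lift)

lemma kalgebra_hom_pres_lift: "kalgebra_hom (presented_algebra R) B (pres_lift B h)"
proof -
  have "kalgebra_hom (presented_algebra R) B (\<lambda>C. the_elem (free_lift B h ` C))"
    unfolding presented_algebra_def
    by (rule F.kalgebra_hom_quot) (auto intro: ideal_genideal_free F.genideal_kernel[OF _ R])
  then show ?thesis by (simp add: pres_lift_def[abs_def])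
qed

lemma pres_lift_gen: "pres_lift B h (pres_gen R x) = h x"
proof -
  have "free_lift B h ` (pres_gen R x) = {free_lift B h (Poly_Mapping.single [x] 1)}"
    unfolding pres_gen_def
    by (rule F.image_rcos) (auto intro: ideal_genideal_free F.genideal_kernel[OF _ R])
  then show ?thesis by (simp add: pres_lift_def free_lift_single h)
qed

end

end

section \<open>Presented algebras\<close>

lemma kalgebra_presented_algebra: "kalgebra (presented_algebra R)"
  unfolding presented_algebra_def
  \<comment> \<open>The lemma on generated ideals comes from a context over a target algebra; the
    scalar algebra fills that slot.\<close>
  by (intro kalgebra_quot_algebra kalgebra_free_algebra ideal_genideal_free[OF kalgebra_scalar_algebra])
     simp

lemma kalgebra_hom_presented_rcos:
  "kalgebra_hom free_algebra (presented_algebra R) (\<lambda>x. Idl\<^bsub>free_algebra\<^esub> R +>\<^bsub>free_algebra\<^esub> x)"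
  unfolding presented_algebra_def
  by (intro kalgebra_hom_rcos kalgebra_free_algebra ideal_genideal_free[OF kalgebra_scalar_algebra])
     simp

text \<open>Turns a defining relation, which is an equality of cosets of words, into an equation
  between products of generators.\<close>

lemma presented_rcos_single:
  "Idl\<^bsub>free_algebra\<^esub> R +>\<^bsub>free_algebra\<^esub> Poly_Mapping.single w c =
    c \<odot>\<^bsub>presented_algebra R\<^esub> foldr (\<lambda>x y. pres_gen R x \<otimes>\<^bsub>presented_algebra R\<^esub> y) w \<one>\<^bsub>presented_algebra R\<^esub>"
proof -
  interpret kalgebra_hom free_algebra "presented_algebra R" "\<lambda>x. Idl\<^bsub>free_algebra\<^esub> R +>\<^bsub>free_algebra\<^esub> x"
    by (rule kalgebra_hom_presented_rcos)
  have "Idl\<^bsub>free_algebra\<^esub> R +>\<^bsub>free_algebra\<^esub> Poly_Mapping.single w 1 =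
    foldr (\<lambda>x y. pres_gen R x \<otimes>\<^bsub>presented_algebra R\<^esub> y) w \<one>\<^bsub>presented_algebra R\<^esub>"
  proof (induction w)
    case (Cons x w)
    have "Poly_Mapping.single (x # w) 1 = Poly_Mapping.single [x] 1 \<otimes>\<^bsub>free_algebra\<^esub> Poly_Mapping.single w 1"
      by simp
    then show ?case
      using mult[of "Poly_Mapping.single [x] 1" "Poly_Mapping.single w 1"] Cons
      by (simp add: pres_gen_def)
  qed (use one in simp)
  with smult[of "Poly_Mapping.single w 1" c] show ?thesis by (simp add: map_times_simps)
qed

lemma presented_rcos_eq:
  assumes "f - g \<in> R"
  shows "Idl\<^bsub>free_algebra\<^esub> R +>\<^bsub>free_algebra\<^esub> f = Idl\<^bsub>free_algebra\<^esub> R +>\<^bsub>free_algebra\<^esub> g"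
proof -
  interpret F: kalgebra free_algebra by (rule kalgebra_free_algebra)
  show ?thesis using assms F.genideal_self[of R]
    by (intro rcos_eqI kalgebra_free_algebra ideal_genideal_free[OF kalgebra_scalar_algebra]) auto
qed

lemma pres_gen_closed: "pres_gen R x \<in> carrier (presented_algebra R)"
  by (simp add: pres_gen_def presented_algebra_def quot_algebra_simps)

section \<open>Polynomials in an element and oscillator pairs\<close>

text \<open>Gaussian binomials by the Pascal rule, in the version adapted to moving \<open>Z\<close>
  rightwards past Y^k at the cost of Q^k. A quotient of q-factorials would meet zero denominators at
  roots of unity.\<close>

primrec q_binomial :: "'k::field \<Rightarrow> nat \<Rightarrow> nat \<Rightarrow> 'k" where
  "q_binomial Q 0 k = (if k = 0 then 1 else 0)"
| "q_binomial Q (Suc n) k =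
    (case k of 0 \<Rightarrow> 1 | Suc j \<Rightarrow> q_binomial Q n j + Q ^ k * q_binomial Q n k)"

lemma q_binomial_0_right [simp]: "q_binomial Q n 0 = 1"
  by (cases n) auto

lemma q_binomial_eq_0 [simp]: "n < k \<Longrightarrow> q_binomial Q n k = 0"
  by (induction n arbitrary: k) (auto split: nat.splits)

lemma q_binomial_self [simp]: "q_binomial Q n n = 1"
  by (induction n) auto

text \<open>Division-free form of [n+1, k+1] = [n+1]/[k+1] [n, k]. It yields the vanishing at roots
  of unity as well as the lower-order coefficients in \<open>Z_mult_normal_form\<close>.\<close>

lemma q_binomial_absorption:
  "q_binomial Q (Suc n) (Suc k) * (1 - Q ^ Suc k) = (1 - Q ^ Suc n) * q_binomial Q n k"
proof (induction n arbitrary: k)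
  case (Suc n)
  show ?case
  proof (cases k)
    case 0
    define x where "x = q_binomial Q (Suc n) (Suc 0)"
    have x: "x * (1 - Q) = 1 - Q ^ Suc n"
      using Suc.IH[of 0] by (simp only: x_def q_binomial_0_right power_Suc0_right mult_1_right)
    have "q_binomial Q (Suc (Suc n)) (Suc k) = 1 + Q * x"
      using 0 by (simp add: x_def)
    then have "q_binomial Q (Suc (Suc n)) (Suc k) * (1 - Q ^ Suc k) = 1 - Q + Q * (x * (1 - Q))"
      using 0 by (simp add: algebra_simps)
    also have "\<dots> = 1 - Q ^ Suc (Suc n)"
      unfolding x by (simp add: algebra_simps)
    finally show ?thesis using 0 by simp
  next
    case (Suc j)
    define a where "a = q_binomial Q (Suc n) k"
    define b where "b = q_binomial Q n j"
    define d where "d = q_binomial Q n k"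
    define c where "c = q_binomial Q (Suc n) (Suc k)"
    have 1: "a = b + Q ^ k * d" by (simp add: a_def b_def d_def Suc)
    have 2: "a * (1 - Q ^ k) = (1 - Q ^ Suc n) * b"
      using Suc.IH[of j] by (simp only: a_def b_def Suc)
    have 3: "c * (1 - Q ^ Suc k) = (1 - Q ^ Suc n) * d"
      using Suc.IH[of k] by (simp only: c_def d_def)
    have "q_binomial Q (Suc (Suc n)) (Suc k) * (1 - Q ^ Suc k) = (a + Q ^ Suc k * c) * (1 - Q ^ Suc k)"
      by (simp add: a_def c_def)
    also have "\<dots> = a * (1 - Q ^ Suc k) + Q ^ Suc k * ((1 - Q ^ Suc n) * d)"
      by (simp only: distrib_right mult.assoc 3)
    also have "\<dots> = (1 - Q ^ Suc (Suc n)) * a"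
    proof -
      \<comment> \<open>\<open>P\<close> and \<open>S\<close> stand for Q^k and Q^(n+1): with the
        powers treated as indeterminates, the claim is a polynomial consequence of the Pascal rule
        and the induction hypothesis.\<close>
      have "a * (1 - Q * P) + Q * P * ((1 - S) * d) = (1 - Q * S) * a"
        if that: "a = b + P * d" "a * (1 - P) = (1 - S) * b" for P S
      proof -
        have aP: "a * P = a - b + S * b" using that(2) by (simp add: algebra_simps)
        have "a * (1 - Q * P) + Q * P * ((1 - S) * d) - (1 - Q * S) * a =
            Q * (S * a - a * P + P * d - P * S * d)"
          by (simp add: algebra_simps)
        also have "\<dots> = Q * (S * (b + P * d) - (a - b + S * b) + P * d - P * S * d)"
          unfolding aP by (simp only: that(1))
        also have "\<dots> = 0" unfolding that(1) by (simp add: algebra_simps)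
        finally show ?thesis by simp
      qed
      from this[OF 1 2] show ?thesis unfolding power_Suc[of Q k] power_Suc[of Q "Suc n"] .
    qed
    finally show ?thesis by (simp only: a_def)
  qed
qed (auto split: nat.splits)

lemma primitive_root_power_ne_1:
  "\<lbrakk>primitive_root_of_unity N Q; 0 < k; k < N\<rbrakk> \<Longrightarrow> Q ^ k \<noteq> 1"
  by (auto simp: primitive_root_of_unity_def)

text \<open>For n + 1 = N the right-hand side of the absorption identity is 0, whereas 1 - Q^k is
  invertible.\<close>

lemma q_binomial_root_of_unity:
  assumes "primitive_root_of_unity N Q" "0 < k" "k < N"
  shows "q_binomial Q N k = 0"
proof -
  obtain n j where n: "N = Suc n" and j: "k = Suc j"
    using assms(2,3) by (metis gr0_implies_Suc less_trans)
  have "q_binomial Q N k * (1 - Q ^ k) = (1 - Q ^ N) * q_binomial Q n j"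
    unfolding n j by (rule q_binomial_absorption)
  with assms primitive_root_power_ne_1[OF assms] show ?thesis
    by (auto simp: primitive_root_of_unity_def)
qed

text \<open>A rescaling of the continuous \<open>q\<close>-Hermite polynomials.\<close>

fun q_hermite :: "'k::field \<Rightarrow> 'k \<Rightarrow> nat \<Rightarrow> 'k poly" where
  "q_hermite Q c 0 = 1"
| "q_hermite Q c (Suc 0) = [:0, 1:]"
| "q_hermite Q c (Suc (Suc n)) =
    [:0, 1:] * q_hermite Q c (Suc n) - Polynomial.smult (c * (1 - Q ^ Suc n)) (q_hermite Q c n)"

section \<open>Evaluating polynomials at an element of an algebra\<close>

definition poly_eval :: "('k::field, 'a, 'm) module_scheme \<Rightarrow> 'a \<Rightarrow> 'k poly \<Rightarrow> 'a" where
  "poly_eval R u p = fold_coeffs (\<lambda>a r. a \<odot>\<^bsub>R\<^esub> \<one>\<^bsub>R\<^esub> \<oplus>\<^bsub>R\<^esub> u \<otimes>\<^bsub>R\<^esub> r) p \<zero>\<^bsub>R\<^esub>"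

context kalgebra
begin

context
  fixes u assumes u [simp, intro]: "u \<in> carrier R"
begin

lemma poly_eval_0 [simp]: "poly_eval R u 0 = \<zero>"
  by (simp add: poly_eval_def)

lemma poly_eval_pCons [simp]: "poly_eval R u (pCons a p) = a \<odot> \<one> \<oplus> u \<otimes> poly_eval R u p"
  by (cases "p = 0 \<and> a = 0") (auto simp: poly_eval_def fold_coeffs_pCons_eq)

lemma poly_eval_closed [simp, intro]: "poly_eval R u p \<in> carrier R"
  by (induction p) auto

lemma poly_eval_add [simp]: "poly_eval R u (p + p') = poly_eval R u p \<oplus> poly_eval R u p'"
  by (induction p p' rule: poly_induct2) (simp_all add: smult_l_distr r_distr a_ac)

lemma poly_eval_smult [simp]: "poly_eval R u (Polynomial.smult c p) = c \<odot> poly_eval R u p"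
  by (induction p) (simp_all add: smult_r_distr)

lemma poly_eval_one [simp]: "poly_eval R u 1 = \<one>"
  by (simp add: one_pCons)

lemma poly_eval_mult [simp]: "poly_eval R u (p * p') = poly_eval R u p \<otimes> poly_eval R u p'"
  by (induction p) (simp_all add: l_distr m_assoc)

lemma poly_eval_power [simp]: "poly_eval R u (p ^ n) = poly_eval R u p [^] n"
proof (induction n)
  case (Suc n)
  have "p ^ Suc n = p ^ n * p" by (simp add: mult.commute)
  with Suc show ?case by (simp only: poly_eval_mult nat_pow_Suc)
qed simp

lemma poly_eval_diff: "poly_eval R u (p - p') = poly_eval R u p \<oplus> (- 1) \<odot> poly_eval R u p'"
proof -
  have "p - p' = p + Polynomial.smult (- 1) p'" by simp
  then show ?thesis by (simp only: poly_eval_add poly_eval_smult)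
qed

lemma subalgebra_range_poly_eval: "is_subalgebra R (range (poly_eval R u))"
  unfolding is_subalgebra_def
proof (intro conjI allI ballI subringI)
  show "\<one> \<in> range (poly_eval R u)" by (metis poly_eval_one rangeI)
next
  fix c x assume "x \<in> range (poly_eval R u)"
  then show "c \<odot> x \<in> range (poly_eval R u)" by (metis (no_types, lifting) imageE poly_eval_smult rangeI)
next
  fix x assume x: "x \<in> range (poly_eval R u)"
  then have "\<ominus> x = (- 1) \<odot> x" by (auto simp: smult_minus_one)
  with x show "\<ominus> x \<in> range (poly_eval R u)" by (metis (no_types, lifting) imageE poly_eval_smult rangeI)
next
  fix x y assume "x \<in> range (poly_eval R u)" "y \<in> range (poly_eval R u)"
  then show "x \<otimes> y \<in> range (poly_eval R u)" "x \<oplus> y \<in> range (poly_eval R u)"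
    by (auto simp flip: poly_eval_mult poly_eval_add)
qed auto

text \<open>Powers of \<open>u\<close> multiply to powers of \<open>u\<close>, so its polynomials
  are already closed. Questions about the coideal subalgebra thereby become questions about
  polynomials modulo an annihilating one.\<close>

lemma gen_subalgebra_singleton: "gen_subalgebra R {u} = range (poly_eval R u)"
proof
  have "u = poly_eval R u [:0, 1:]" by simp
  then show "gen_subalgebra R {u} \<subseteq> range (poly_eval R u)"
    unfolding gen_subalgebra_def using subalgebra_range_poly_eval by blast
  have "poly_eval R u p \<in> S" if S: "is_subalgebra R S" "u \<in> S" for S p
  proof -
    from S have "subring S R" "\<And>c x. x \<in> S \<Longrightarrow> c \<odot> x \<in> S" by (auto simp: is_subalgebra_def)
    note * = subringE[OF this(1)] this(2)
    show ?thesis by (induction p) (auto intro!: * S(2))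
  qed
  then show "range (poly_eval R u) \<subseteq> gen_subalgebra R {u}"
    unfolding gen_subalgebra_def by auto
qed

end

lemma pow_mult_self: "x \<in> carrier R \<Longrightarrow> x \<otimes> x [^] (n::nat) = x [^] n \<otimes> x"
  by (induction n) (simp_all add: m_assoc[symmetric])

lemma pow_mult_self_assoc:
  "\<lbrakk>x \<in> carrier R; y \<in> carrier R\<rbrakk> \<Longrightarrow> x \<otimes> (x [^] (n::nat) \<otimes> y) = x [^] n \<otimes> (x \<otimes> y)"
  by (simp add: pow_mult_self m_assoc[symmetric])

section \<open>Normal ordering for an oscillator pair\<close>

context
  fixes Y Z c Q
  assumes Y [simp]: "Y \<in> carrier R" and Z [simp]: "Z \<in> carrier R"
    and ZY: "Z \<otimes> Y = Q \<odot> (Y \<otimes> Z) \<oplus> ((1 - Q) * c) \<odot> \<one>"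
begin

text \<open>Each passage of \<open>Z\<close> across a \<open>Y\<close> costs a factor Q and leaves a
  scalar; the scalars add up to c (1 - Q)(1 + Q + ... + Q^k), which telescopes.\<close>

lemma oscillator_mult_pow:
  "Z \<otimes> Y [^] Suc k = Q ^ Suc k \<odot> (Y [^] Suc k \<otimes> Z) \<oplus> (c * (1 - Q ^ Suc k)) \<odot> Y [^] k"
proof (induction k)
  case (Suc k)
  have "Z \<otimes> Y [^] Suc (Suc k) = (Z \<otimes> Y [^] Suc k) \<otimes> Y"
    by (simp add: m_assoc)
  also have "\<dots> = Q ^ Suc k \<odot> (Y [^] Suc k \<otimes> (Z \<otimes> Y)) \<oplus> (c * (1 - Q ^ Suc k)) \<odot> Y [^] Suc k"
    unfolding Suc.IH by (simp add: m_assoc l_distr)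
  also have "\<dots> = Q ^ Suc (Suc k) \<odot> (Y [^] Suc (Suc k) \<otimes> Z)
      \<oplus> (Q ^ Suc k * ((1 - Q) * c) + c * (1 - Q ^ Suc k)) \<odot> Y [^] Suc k"
    unfolding ZY by (simp add: r_distr smult_r_distr smult_l_distr m_assoc a_assoc mult.commute)
  also have "Q ^ Suc k * ((1 - Q) * c) + c * (1 - Q ^ Suc k) = c * (1 - Q ^ Suc (Suc k))"
    by (simp add: algebra_simps)
  finally show ?case .
qed (simp add: ZY mult.commute)

private abbreviation "normal_form n \<equiv> (\<Oplus>k\<in>{..n}. q_binomial Q n k \<odot> (Y [^] k \<otimes> Z [^] (n - k)))"

text \<open>The two summands of the Pascal rule are summed separately. The first is \<open>Y\<close>
  times the old normal form; the second is what left multiplication by \<open>Z\<close> would give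
  if Z Y were just Q Y Z.\<close>

lemma normal_form_Suc:
  "normal_form (Suc n) = Y \<otimes> normal_form n \<oplus>
    (\<Oplus>k\<in>{..n}. (Q ^ k * q_binomial Q n k) \<odot> (Y [^] k \<otimes> Z [^] (Suc n - k)))"
proof -
  have "normal_form (Suc n) =
    (\<Oplus>k\<in>{..n}. q_binomial Q n k \<odot> (Y [^] Suc k \<otimes> Z [^] (n - k)) \<oplus>
      (Q ^ Suc k * q_binomial Q n (Suc k)) \<odot> (Y [^] Suc k \<otimes> Z [^] (n - k))) \<oplus> Z [^] Suc n"
    by (subst finsum_Suc2) (auto simp: smult_l_distr simp del: nat_pow_Suc power_Suc)
  also have "\<dots> = (\<Oplus>k\<in>{..n}. q_binomial Q n k \<odot> (Y [^] Suc k \<otimes> Z [^] (n - k))) \<oplus>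
    ((\<Oplus>k\<in>{..n}. (Q ^ Suc k * q_binomial Q n (Suc k)) \<odot> (Y [^] Suc k \<otimes> Z [^] (n - k))) \<oplus> Z [^] Suc n)"
    by (subst finsum_addf) (auto simp: a_assoc finsum_closed simp del: nat_pow_Suc power_Suc)
  \<comment> \<open>The range is shifted by restoring k = 0, the term Z^(n+1); the new top index n +
    1 then drops out because [n, n+1] = 0.\<close>
  also have "(\<Oplus>k\<in>{..n}. (Q ^ Suc k * q_binomial Q n (Suc k)) \<odot> (Y [^] Suc k \<otimes> Z [^] (n - k))) \<oplus> Z [^] Suc n
    = (\<Oplus>k\<in>{..Suc n}. (Q ^ k * q_binomial Q n k) \<odot> (Y [^] k \<otimes> Z [^] (Suc n - k)))"
    by (subst finsum_Suc2) (auto simp del: nat_pow_Suc power_Suc)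
  also have "\<dots> = (\<Oplus>k\<in>{..n}. (Q ^ k * q_binomial Q n k) \<odot> (Y [^] k \<otimes> Z [^] (Suc n - k)))"
    by (subst finsum_Suc) (auto simp: finsum_closed simp del: nat_pow_Suc power_Suc)
  also have "(\<Oplus>k\<in>{..n}. q_binomial Q n k \<odot> (Y [^] Suc k \<otimes> Z [^] (n - k))) = Y \<otimes> normal_form n"
    by (subst finsum_rdistr) (auto intro!: finsum_cong' simp: pow_mult_self_assoc m_assoc)
  finally show ?thesis .
qed

text \<open>By absorption, the remainders from \<open>oscillator_mult_pow\<close> recombine into a
  single multiple of \<open>normal_form m\<close>. This multiple is exactly what the recursion of
  \<open>q_hermite\<close> subtracts.\<close>

lemma Z_mult_normal_form:
  "Z \<otimes> normal_form (Suc m) =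
    (\<Oplus>k\<in>{..Suc m}. (Q ^ k * q_binomial Q (Suc m) k) \<odot> (Y [^] k \<otimes> Z [^] (Suc (Suc m) - k)))
      \<oplus> (c * (1 - Q ^ Suc m)) \<odot> normal_form m"
proof -
  let ?f = "\<lambda>n k. Y [^] k \<otimes> Z [^] (n - k)"
  have "Z \<otimes> normal_form (Suc m) = (\<Oplus>k\<in>{..Suc m}. q_binomial Q (Suc m) k \<odot> (Z \<otimes> Y [^] k \<otimes> Z [^] (Suc m - k)))"
    by (subst finsum_rdistr) (auto intro!: finsum_cong' simp: m_assoc simp del: nat_pow_Suc)
  also have "\<dots> = (\<Oplus>k\<in>{..m}. q_binomial Q (Suc m) (Suc k) \<odot> (Z \<otimes> Y [^] Suc k \<otimes> Z [^] (m - k)))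
      \<oplus> Z [^] Suc (Suc m)"
    by (subst finsum_Suc2) (auto simp: pow_mult_self pow_mult_self_assoc m_assoc)
  also have "\<dots> = (\<Oplus>k\<in>{..m}. (Q ^ Suc k * q_binomial Q (Suc m) (Suc k)) \<odot> ?f (Suc (Suc m)) (Suc k)
      \<oplus> (c * (1 - Q ^ Suc m)) \<odot> (q_binomial Q m k \<odot> ?f m k)) \<oplus> Z [^] Suc (Suc m)"
  proof -
    have "q_binomial Q (Suc m) (Suc k) \<odot> (Z \<otimes> Y [^] Suc k \<otimes> Z [^] (m - k)) =
      (Q ^ Suc k * q_binomial Q (Suc m) (Suc k)) \<odot> ?f (Suc (Suc m)) (Suc k)
      \<oplus> (c * (1 - Q ^ Suc m)) \<odot> (q_binomial Q m k \<odot> ?f m k)" if "k \<le> m" for k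
    proof -
      have "Suc m - k = Suc (m - k)" using that by auto
      then have Zk: "Z [^] (Suc m - k) = Z \<otimes> Z [^] (m - k)" by (simp add: pow_mult_self)
      have coeff: "q_binomial Q (Suc m) (Suc k) * (c * (1 - Q ^ Suc k)) = q_binomial Q m k * (c * (1 - Q ^ Suc m))"
        by (simp only: mult.left_commute[of _ c] q_binomial_absorption mult.commute[of "q_binomial Q m k"])
      then show ?thesis
        unfolding oscillator_mult_pow
        by (simp add: l_distr smult_r_distr m_assoc Zk mult.commute coeff del: nat_pow_Suc power_Suc q_binomial.simps)
    qed
    then have "(\<Oplus>k\<in>{..m}. q_binomial Q (Suc m) (Suc k) \<odot> (Z \<otimes> Y [^] Suc k \<otimes> Z [^] (m - k))) =
       (\<Oplus>k\<in>{..m}. (Q ^ Suc k * q_binomial Q (Suc m) (Suc k)) \<odot> ?f (Suc (Suc m)) (Suc k)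
      \<oplus> (c * (1 - Q ^ Suc m)) \<odot> (q_binomial Q m k \<odot> ?f m k))"
      by (intro finsum_cong' refl) (auto simp del: nat_pow_Suc power_Suc q_binomial.simps)
    then show ?thesis by simp
  qed
  also have "\<dots> = ((\<Oplus>k\<in>{..m}. (Q ^ Suc k * q_binomial Q (Suc m) (Suc k)) \<odot> ?f (Suc (Suc m)) (Suc k))
      \<oplus> Z [^] Suc (Suc m)) \<oplus> (c * (1 - Q ^ Suc m)) \<odot> normal_form m"
    by (subst finsum_addf)
       (auto simp: a_ac finsum_closed smult_finsum simp del: nat_pow_Suc power_Suc q_binomial.simps)
  also have "(\<Oplus>k\<in>{..m}. (Q ^ Suc k * q_binomial Q (Suc m) (Suc k)) \<odot> ?f (Suc (Suc m)) (Suc k))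
      \<oplus> Z [^] Suc (Suc m) =
      (\<Oplus>k\<in>{..Suc m}. (Q ^ k * q_binomial Q (Suc m) k) \<odot> ?f (Suc (Suc m)) k)"
    by (subst finsum_Suc2) (auto simp del: nat_pow_Suc power_Suc q_binomial.simps)
  finally show ?thesis .
qed

lemma poly_eval_q_hermite: "poly_eval R (Y \<oplus> Z) (q_hermite Q c n) = normal_form n"
proof (induction n rule: induct_nat_012)
  case 1
  show ?case using normal_form_Suc[of 0] by simp
next
  case (ge2 m)
  let ?B = "normal_form (Suc m)" and ?C = "normal_form m"
  let ?S = "\<Oplus>k\<in>{..Suc m}. (Q ^ k * q_binomial Q (Suc m) k) \<odot> (Y [^] k \<otimes> Z [^] (Suc (Suc m) - k))"
  have closed: "?B \<in> carrier R" "?C \<in> carrier R" "?S \<in> carrier R"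
    by (auto intro!: finsum_closed)
  have "poly_eval R (Y \<oplus> Z) (q_hermite Q c (Suc (Suc m))) =
      (Y \<oplus> Z) \<otimes> ?B \<oplus> (- 1) \<odot> ((c * (1 - Q ^ Suc m)) \<odot> ?C)"
    using closed by (simp only: q_hermite.simps poly_eval_diff poly_eval_mult poly_eval_smult ge2
        poly_eval_pCons a_closed Y Z) (simp del: q_binomial.simps power_Suc)
  also have "\<dots> = Y \<otimes> ?B \<oplus> ((?S \<oplus> (c * (1 - Q ^ Suc m)) \<odot> ?C) \<oplus> (- 1) \<odot> ((c * (1 - Q ^ Suc m)) \<odot> ?C))"
    using closed by (simp only: l_distr Y Z Z_mult_normal_form a_assoc a_closed m_closed smult_closed)
  also have "(?S \<oplus> (c * (1 - Q ^ Suc m)) \<odot> ?C) \<oplus> (- 1) \<odot> ((c * (1 - Q ^ Suc m)) \<odot> ?C) = ?S"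
    using closed by (simp only: smult_minus_one smult_closed a_assoc r_neg r_zero a_inv_closed)
  finally show ?case by (simp only: normal_form_Suc)
qed simp

lemma poly_eval_q_hermite_root_of_unity:
  assumes "primitive_root_of_unity N Q"
  shows "poly_eval R (Y \<oplus> Z) (q_hermite Q c N) = Y [^] N \<oplus> Z [^] N"
proof -
  from assms have "0 < N" by (simp add: primitive_root_of_unity_def)
  then obtain n where n: "N = Suc n" by (cases N) auto
  have *: "(\<Oplus>k\<in>{..n}. q_binomial Q N (Suc k) \<odot> (Y [^] Suc k \<otimes> Z [^] (N - Suc k))) = Y [^] N"
  proof (cases n)
    case (Suc m)
    have "(\<Oplus>k\<in>{..m}. q_binomial Q N (Suc k) \<odot> (Y [^] Suc k \<otimes> Z [^] (N - Suc k))) = \<zero>"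
    proof (rule add.finprod_one_eqI)
      fix k assume "k \<in> {..m}"
      then have "q_binomial Q N (Suc k) = 0"
        by (intro q_binomial_root_of_unity[OF assms]) (simp_all add: n Suc)
      then show "q_binomial Q N (Suc k) \<odot> (Y [^] Suc k \<otimes> Z [^] (N - Suc k)) = \<zero>" by simp
    qed
    then show ?thesis unfolding Suc
      by (subst finsum_Suc) (auto simp: n Suc simp del: q_binomial.simps(2) nat_pow_Suc)
  qed (simp add: n)
  show ?thesis
    unfolding poly_eval_q_hermite
    by (simp only: n, subst finsum_Suc2) (use * in \<open>auto simp: n simp del: q_binomial.simps(2) nat_pow_Suc\<close>)
qed

end

lemma q_hermite_c_0: "q_hermite Q 0 n = [:0, 1:] ^ n"
  by (induction Q "0 :: 'b" n rule: q_hermite.induct) auto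

text \<open>The case c = 0 of the oscillator identity, where the q-Hermite polynomial is x^N. It
  handles the coproducts of \<open>E\<close> and \<open>F\<close> and later the N-th powers of the
  two halves of the generator.\<close>

lemma q_binomial_theorem_root_of_unity:
  assumes "Y \<in> carrier R" "Z \<in> carrier R" "Z \<otimes> Y = Q \<odot> (Y \<otimes> Z)" "primitive_root_of_unity N Q"
  shows "(Y \<oplus> Z) [^] N = Y [^] N \<oplus> Z [^] N"
  using poly_eval_q_hermite_root_of_unity[of Y Z Q 0 N] assms
  by (simp add: q_hermite_c_0)

end

section \<open>Tensor products\<close>

lemma tensor_subspace_eq_image:
  "tensor_subspace A B S S' =
     (\<lambda>f. tensor_ideal A B +>\<^bsub>monoid_algebra (A \<times>\<times> B)\<^esub> f) ` {f. Poly_Mapping.keys f \<subseteq> S \<times> S'}"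
  by (auto simp: tensor_subspace_def)

context
  fixes A :: "('k::field, 'a, 'm) module_scheme" and B :: "('k, 'b, 'n) module_scheme"
  assumes A: "kalgebra A" and B: "kalgebra B"
begin

interpretation A: kalgebra A by (rule A)
interpretation B: kalgebra B by (rule B)

private abbreviation (input) "AB \<equiv> monoid_algebra (A \<times>\<times> B) :: ('k, ('a \<times> 'b) \<Rightarrow>\<^sub>0 'k) module"
private abbreviation (input) "T \<equiv> tensor_algebra A B"

lemma kalgebra_AB: "kalgebra AB"
  by (rule kalgebra_monoid_algebra[OF DirProd_monoid[OF A.monoid_axioms B.monoid_axioms]])

interpretation AB: kalgebra AB by (rule kalgebra_AB)

lemma carrier_AB [simp]: "carrier AB = {f. Poly_Mapping.keys f \<subseteq> carrier A \<times> carrier B}"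
  by (simp add: monoid_algebra_simps)

lemma keys_diff_subset:
  fixes f g :: "'x \<Rightarrow>\<^sub>0 'y::ab_group_add"
  shows "Poly_Mapping.keys (f - g) \<subseteq> Poly_Mapping.keys f \<union> Poly_Mapping.keys g"
  by (auto simp: in_keys_iff lookup_minus)

lemma bilinear_rels_carrier: "bilinear_rels A B \<subseteq> carrier AB"
proof -
  have diff: "f - g \<in> carrier AB" if "f \<in> carrier AB" "g \<in> carrier AB" for f g
    using that keys_diff_subset[of f g] by auto
  have single: "Poly_Mapping.single (a, b) c \<in> carrier AB" if "a \<in> carrier A" "b \<in> carrier B" for a b c
    using that by auto
  show ?thesis unfolding bilinear_rels_def
    by (auto intro!: diff single simp del: carrier_AB)
qed

lemma ideal_tensor_ideal: "ideal (tensor_ideal A B) AB"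
  unfolding tensor_ideal_def by (rule AB.genideal_ideal[OF bilinear_rels_carrier])

lemma kalgebra_tensor_algebra: "kalgebra T"
  unfolding tensor_algebra_def by (rule kalgebra_quot_algebra[OF kalgebra_AB ideal_tensor_ideal])

interpretation T: kalgebra_hom AB T "\<lambda>f. tensor_ideal A B +>\<^bsub>AB\<^esub> f"
  unfolding tensor_algebra_def by (rule kalgebra_hom_rcos[OF kalgebra_AB ideal_tensor_ideal])

lemma tensor_rcos_eqI:
  assumes "f - g \<in> bilinear_rels A B" "f \<in> carrier AB" "g \<in> carrier AB"
  shows "tensor_ideal A B +>\<^bsub>AB\<^esub> f = tensor_ideal A B +>\<^bsub>AB\<^esub> g"
proof (rule rcos_eqI[OF kalgebra_AB ideal_tensor_ideal assms(2,3)])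
  show "f \<ominus>\<^bsub>AB\<^esub> g \<in> tensor_ideal A B"
    unfolding kalgebra_minus_eq[OF kalgebra_AB assms(2,3)] tensor_ideal_def
    using AB.genideal_self[OF bilinear_rels_carrier] assms(1) by blast
qed

lemma tensor_closed [simp]: "\<lbrakk>a \<in> carrier A; b \<in> carrier B\<rbrakk> \<Longrightarrow> tensor A B a b \<in> carrier T"
  unfolding tensor_def by (rule T.closed) simp

lemma tensor_one: "\<one>\<^bsub>T\<^esub> = tensor A B \<one>\<^bsub>A\<^esub> \<one>\<^bsub>B\<^esub>"
  unfolding tensor_def T.one[symmetric] by (simp add: monoid_algebra_simps DirProd_def)

lemma tensor_mult:
  assumes "a \<in> carrier A" "b \<in> carrier B" "a' \<in> carrier A" "b' \<in> carrier B"
  shows "tensor A B a b \<otimes>\<^bsub>T\<^esub> tensor A B a' b' = tensor A B (a \<otimes>\<^bsub>A\<^esub> a') (b \<otimes>\<^bsub>B\<^esub> b')"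
proof -
  have "symb a b \<in> carrier AB" "symb a' b' \<in> carrier AB" using assms by auto
  from T.mult[OF this] show ?thesis
    unfolding tensor_def by (simp add: DirProd_def)
qed

lemma tensor_add_left:
  assumes "a \<in> carrier A" "a' \<in> carrier A" "b \<in> carrier B"
  shows "tensor A B (a \<oplus>\<^bsub>A\<^esub> a') b = tensor A B a b \<oplus>\<^bsub>T\<^esub> tensor A B a' b"
proof -
  have *: "symb a b \<in> carrier AB" "symb a' b \<in> carrier AB" "symb (a \<oplus>\<^bsub>A\<^esub> a') b \<in> carrier AB"
    using assms by auto
  have "symb (a \<oplus>\<^bsub>A\<^esub> a') b - (symb a b + symb a' b) \<in> bilinear_rels A B"
    using assms unfolding bilinear_rels_def diff_diff_eq[symmetric] by blast
  from tensor_rcos_eqI[OF this *(3)] AB.a_closed[OF *(1,2)] T.add[OF *(1,2)] show ?thesis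
    unfolding tensor_def by (simp only: monoid_algebra_simps)
qed

lemma tensor_add_right:
  assumes "a \<in> carrier A" "b \<in> carrier B" "b' \<in> carrier B"
  shows "tensor A B a (b \<oplus>\<^bsub>B\<^esub> b') = tensor A B a b \<oplus>\<^bsub>T\<^esub> tensor A B a b'"
proof -
  have *: "symb a b \<in> carrier AB" "symb a b' \<in> carrier AB" "symb a (b \<oplus>\<^bsub>B\<^esub> b') \<in> carrier AB"
    using assms by auto
  have "symb a (b \<oplus>\<^bsub>B\<^esub> b') - (symb a b + symb a b') \<in> bilinear_rels A B"
    using assms unfolding bilinear_rels_def diff_diff_eq[symmetric] by blast
  from tensor_rcos_eqI[OF this *(3)] AB.a_closed[OF *(1,2)] T.add[OF *(1,2)] show ?thesis
    unfolding tensor_def by (simp only: monoid_algebra_simps)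
qed

lemma tensor_smult_left:
  assumes "a \<in> carrier A" "b \<in> carrier B"
  shows "tensor A B (c \<odot>\<^bsub>A\<^esub> a) b = c \<odot>\<^bsub>T\<^esub> tensor A B a b"
proof -
  have *: "symb a b \<in> carrier AB" "symb (c \<odot>\<^bsub>A\<^esub> a) b \<in> carrier AB"
    and **: "Poly_Mapping.single (a, b) c \<in> carrier AB"
    using assms by auto
  have "symb (c \<odot>\<^bsub>A\<^esub> a) b - Poly_Mapping.single (a, b) c \<in> bilinear_rels A B"
    using assms unfolding bilinear_rels_def by blast
  from tensor_rcos_eqI[OF this *(2) **] T.smult[OF *(1), of c] show ?thesis
    unfolding tensor_def by (simp add: monoid_algebra_simps map_times_simps)
qed

lemma tensor_smult_right:
  assumes "a \<in> carrier A" "b \<in> carrier B"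
  shows "tensor A B a (c \<odot>\<^bsub>B\<^esub> b) = c \<odot>\<^bsub>T\<^esub> tensor A B a b"
proof -
  have *: "symb a b \<in> carrier AB" "symb a (c \<odot>\<^bsub>B\<^esub> b) \<in> carrier AB"
    and **: "Poly_Mapping.single (a, b) c \<in> carrier AB"
    using assms by auto
  have "symb a (c \<odot>\<^bsub>B\<^esub> b) - Poly_Mapping.single (a, b) c \<in> bilinear_rels A B"
    using assms unfolding bilinear_rels_def by blast
  from tensor_rcos_eqI[OF this *(2) **] T.smult[OF *(1), of c] show ?thesis
    unfolding tensor_def by (simp add: monoid_algebra_simps map_times_simps)
qed

lemma tensor_zero_left: "b \<in> carrier B \<Longrightarrow> tensor A B \<zero>\<^bsub>A\<^esub> b = \<zero>\<^bsub>T\<^esub>"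
  using tensor_smult_left[of "\<zero>\<^bsub>A\<^esub>" b 0] by simp

lemma tensor_zero_right: "a \<in> carrier A \<Longrightarrow> tensor A B a \<zero>\<^bsub>B\<^esub> = \<zero>\<^bsub>T\<^esub>"
  using tensor_smult_right[of a "\<zero>\<^bsub>B\<^esub>" 0] by simp

lemma tensor_pow:
  assumes "a \<in> carrier A" "b \<in> carrier B"
  shows "tensor A B a b [^]\<^bsub>T\<^esub> (n::nat) = tensor A B (a [^]\<^bsub>A\<^esub> n) (b [^]\<^bsub>B\<^esub> n)"
  by (induction n) (use assms in \<open>auto simp: tensor_one tensor_mult\<close>)

lemma tensor_in_subspace:
  "\<lbrakk>a \<in> S; b \<in> S'\<rbrakk> \<Longrightarrow> tensor A B a b \<in> tensor_subspace A B S S'"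
  unfolding tensor_def tensor_subspace_eq_image by (rule imageI) simp

text \<open>Supports in S \<times> S' survive sums and products. Hence the coideal condition for a
  singly generated subalgebra has to be checked only at the generator.\<close>

lemma subalgebra_tensor_subspace:
  assumes S: "is_subalgebra A S" and S': "is_subalgebra B S'"
  shows "is_subalgebra T (tensor_subspace A B S S')"
proof -
  have sub: "subring S A" "subring S' B" using assms by (auto simp: is_subalgebra_def)
  note S = subringE[OF sub(1)] and S' = subringE[OF sub(2)]
  let ?W = "tensor_subspace A B S S'" and ?K = "{f :: ('a \<times> 'b) \<Rightarrow>\<^sub>0 'k. Poly_Mapping.keys f \<subseteq> S \<times> S'}"
  have K: "?K \<subseteq> carrier AB" using S(1) S'(1) by auto
  have add: "x \<oplus>\<^bsub>T\<^esub> y \<in> ?W" if "x \<in> ?W" "y \<in> ?W" for x y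
  proof -
    from that obtain f g where f: "f \<in> ?K" "x = tensor_ideal A B +>\<^bsub>AB\<^esub> f"
      and g: "g \<in> ?K" "y = tensor_ideal A B +>\<^bsub>AB\<^esub> g"
      by (auto simp: tensor_subspace_eq_image)
    then have "x \<oplus>\<^bsub>T\<^esub> y = tensor_ideal A B +>\<^bsub>AB\<^esub> (f + g)"
      using T.add[of f g] K by (simp only: monoid_algebra_simps subset_iff)
    moreover have "f + g \<in> ?K" using f g keys_add[of f g] by auto
    ultimately show ?thesis unfolding tensor_subspace_eq_image by (rule image_eqI)
  qed
  have mult: "x \<otimes>\<^bsub>T\<^esub> y \<in> ?W" if "x \<in> ?W" "y \<in> ?W" for x y
  proof -
    from that obtain f g where f: "f \<in> ?K" "x = tensor_ideal A B +>\<^bsub>AB\<^esub> f"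
      and g: "g \<in> ?K" "y = tensor_ideal A B +>\<^bsub>AB\<^esub> g"
      by (auto simp: tensor_subspace_eq_image)
    then have "x \<otimes>\<^bsub>T\<^esub> y = tensor_ideal A B +>\<^bsub>AB\<^esub> (f \<otimes>\<^bsub>AB\<^esub> g)"
      using T.mult[of f g] K by (simp only: subset_iff)
    moreover have "Poly_Mapping.keys (f \<otimes>\<^bsub>AB\<^esub> g) \<subseteq> S \<times> S'"
      by (rule keys_monoid_algebra_mult) (use f g S S' in \<open>auto simp: DirProd_def\<close>)
    ultimately show ?thesis unfolding tensor_subspace_eq_image by (intro image_eqI) auto
  qed
  have smult: "c \<odot>\<^bsub>T\<^esub> x \<in> ?W" if "x \<in> ?W" for c x
  proof -
    from that obtain f where f: "f \<in> ?K" "x = tensor_ideal A B +>\<^bsub>AB\<^esub> f"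
      by (auto simp: tensor_subspace_eq_image)
    then have "c \<odot>\<^bsub>T\<^esub> x = tensor_ideal A B +>\<^bsub>AB\<^esub> (Poly_Mapping.map ((*) c) f)"
      using T.smult[of f c] K by (simp only: monoid_algebra_simps subset_iff)
    moreover have "Poly_Mapping.map ((*) c) f \<in> ?K" using f keys_map_times[of c f] by auto
    ultimately show ?thesis unfolding tensor_subspace_eq_image by (rule image_eqI)
  qed
  have carrier: "?W \<subseteq> carrier T"
    unfolding tensor_subspace_eq_image using K by (auto intro!: T.closed)
  have one: "\<one>\<^bsub>T\<^esub> \<in> ?W"
    unfolding tensor_one by (rule tensor_in_subspace[OF S(3) S'(3)])
  show ?thesis
    unfolding is_subalgebra_def
  proof (intro conjI T.B.subringI)
    fix x assume "x \<in> ?W"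
    then show "\<ominus>\<^bsub>T\<^esub> x \<in> ?W" using smult[of x "- 1"] carrier by (auto simp: T.B.smult_minus_one)
  qed (use carrier one add mult smult in auto)
qed

end

section \<open>The comultiplication\<close>

declare One_nat_def [simp del] \<comment> \<open>it turns the exponent \<open>N - 1\<close> into \<open>N - Suc 0\<close>\<close>

text \<open>Three elements satisfying the relations amount to a homomorphism out of the quantum
  group. The locale is met by the generators themselves, by scalars for the counit, by elements of
  the tensor square for the comultiplication, and by endomorphisms for the Verma module.\<close>

locale Uq_triple = kalgebra B for B :: "('k::field, 'b, 'm) module_scheme" (structure) +
  fixes N :: nat and q :: 'k and k e f :: 'b
  assumes k_closed [simp]: "k \<in> carrier B"
    and e_closed [simp]: "e \<in> carrier B"
    and f_closed [simp]: "f \<in> carrier B"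
    and k_pow: "k [^] N = \<one>"
    and k_e: "k \<otimes> e = q ^ 2 \<odot> (e \<otimes> k)"
    and k_f: "k \<otimes> f = inverse (q ^ 2) \<odot> (f \<otimes> k)"
    and e_pow: "e [^] N = \<zero>"
    and f_pow: "f [^] N = \<zero>"
    and e_f: "e \<otimes> f = f \<otimes> e \<oplus>
      ((1 / (q - inverse q)) \<odot> k \<oplus> (- (1 / (q - inverse q))) \<odot> k [^] (N - 1))"

lemma (in kalgebra) mult_funpow_one: "x \<in> carrier R \<Longrightarrow> ((\<otimes>) x ^^ n) \<one> = x [^] n"
  by (induction n) (simp_all add: pow_mult_self)

lemma (in kalgebra) add_diff_diff_eq_zero:
  assumes "x \<in> carrier R" "y \<in> carrier R"
  shows "(x \<oplus> y) \<oplus> (- 1) \<odot> x \<oplus> (- 1) \<odot> y = \<zero>"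
  using assms by (simp add: smult_minus_one a_comm[of x y] a_assoc r_neg)

lemma free_lift_diff:
  fixes B (structure)
  assumes "kalgebra B" "\<And>x. h x \<in> carrier B"
  shows "free_lift B h (x - y) = free_lift B h x \<oplus> (- 1) \<odot> free_lift B h y"
proof -
  interpret kalgebra_hom free_algebra B "free_lift B h" by (rule kalgebra_hom_free_lift) fact+
  show ?thesis using minus[of x y] by (simp add: B.minus_eq_smult)
qed

section \<open>Homomorphisms out of the quantum group\<close>

context
  fixes B :: "('k::field, 'b, 'm) module_scheme" (structure) and N :: nat and q :: 'k and h
  assumes triple: "Uq_triple B N q (h GK) (h GE) (h GF)"
begin

interpretation Uq_triple B N q "h GK" "h GE" "h GF" by (rule triple)

lemma Uq_gen_closed: "h x \<in> carrier B"
  by (cases x) auto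

lemma Uq_rels_free_lift: "r \<in> Uq_rels N q \<Longrightarrow> free_lift B h r = \<zero>"
proof -
  assume r: "r \<in> Uq_rels N q"
  let ?l = "free_lift B h" and ?d = "1 / (q - inverse q)"
  note rules = free_lift_diff[OF kalgebra_axioms Uq_gen_closed]
    free_lift_single[OF kalgebra_axioms Uq_gen_closed] mult_funpow_one
  \<comment> \<open>The commutator relation is first put into the form x = y + z, the shape of
    \<open>e_f\<close>, and then brought back to a difference.\<close>
  have "?l (Poly_Mapping.single [GE, GF] 1 - Poly_Mapping.single [GF, GE] 1
      - (Poly_Mapping.single [GK] ?d - Poly_Mapping.single (replicate (N - 1) GK) ?d)) = \<zero>"
  proof -
    have "?l (Poly_Mapping.single [GE, GF] 1) = ?l (Poly_Mapping.single [GF, GE] 1) \<oplus>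
        ?l (Poly_Mapping.single [GK] ?d - Poly_Mapping.single (replicate (N - 1) GK) ?d)"
      by (simp add: rules e_f)
    moreover have "?l x \<in> carrier B" for x
      by (rule free_lift_closed[OF kalgebra_axioms Uq_gen_closed])
    ultimately show ?thesis
      by (simp only: rules(1) add_diff_diff_eq_zero a_closed smult_closed)
  qed
  with r show ?thesis
    unfolding Uq_rels_def
    by (elim insertE emptyE)
       (simp_all add: rules k_pow k_e k_f e_pow f_pow smult_minus_one smult_minus_left r_neg)
qed

lemma kalgebra_hom_Uq_alg: "kalgebra_hom (Uq_alg N q) B (pres_lift B h)"
  unfolding Uq_alg_def
  by (rule kalgebra_hom_pres_lift[OF kalgebra_axioms Uq_gen_closed Uq_rels_free_lift])

lemma pres_lift_Uq:
  "pres_lift B h (K\<^sub>q N q) = h GK" "pres_lift B h (E\<^sub>q N q) = h GE" "pres_lift B h (F\<^sub>q N q) = h GF"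
  unfolding K\<^sub>q_def E\<^sub>q_def F\<^sub>q_def
  by (rule pres_lift_gen[OF kalgebra_axioms Uq_gen_closed Uq_rels_free_lift], assumption)+

end

lemma Uq_triple_Uq_alg: "Uq_triple (Uq_alg N q) N q (K\<^sub>q N q) (E\<^sub>q N q) (F\<^sub>q N q)"
proof -
  let ?U = "Uq_alg N q" and ?R = "Uq_rels N q"
  let ?p = "\<lambda>x. Idl\<^bsub>free_algebra\<^esub> ?R +>\<^bsub>free_algebra\<^esub> x"
  interpret U: kalgebra ?U unfolding Uq_alg_def by (rule kalgebra_presented_algebra)
  interpret P: kalgebra_hom free_algebra ?U ?p
    unfolding Uq_alg_def by (rule kalgebra_hom_presented_rcos)
  have closed: "pres_gen ?R x \<in> carrier ?U" for x
    unfolding Uq_alg_def by (rule pres_gen_closed)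
  note single = presented_rcos_single[of ?R, folded Uq_alg_def]
  have add: "?p (x + y) = ?p x \<oplus>\<^bsub>?U\<^esub> ?p y" for x y using P.add[of x y] by simp
  have zero: "?p 0 = \<zero>\<^bsub>?U\<^esub>" using P.zero by simp
  note eq = presented_rcos_eq[of _ _ ?R]
  note simps = single U.mult_funpow_one closed U.m_assoc
  show ?thesis
    unfolding K\<^sub>q_def E\<^sub>q_def F\<^sub>q_def
  proof (intro Uq_triple.intro Uq_triple_axioms.intro U.kalgebra_axioms closed)
    have "?p (Poly_Mapping.single (replicate N GK) 1) = ?p (Poly_Mapping.single [] 1)"
      by (rule eq) (simp add: Uq_rels_def)
    then show "pres_gen ?R GK [^]\<^bsub>?U\<^esub> N = \<one>\<^bsub>?U\<^esub>"
      by (simp add: simps)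
    have "?p (Poly_Mapping.single [GK, GE] 1) = ?p (Poly_Mapping.single [GE, GK] (q ^ 2))"
      by (rule eq) (simp add: Uq_rels_def)
    then show "pres_gen ?R GK \<otimes>\<^bsub>?U\<^esub> pres_gen ?R GE = q ^ 2 \<odot>\<^bsub>?U\<^esub> (pres_gen ?R GE \<otimes>\<^bsub>?U\<^esub> pres_gen ?R GK)"
      by (simp add: simps)
    have "?p (Poly_Mapping.single [GK, GF] 1) = ?p (Poly_Mapping.single [GF, GK] (inverse (q ^ 2)))"
      by (rule eq) (simp add: Uq_rels_def)
    then show "pres_gen ?R GK \<otimes>\<^bsub>?U\<^esub> pres_gen ?R GF = inverse (q ^ 2) \<odot>\<^bsub>?U\<^esub> (pres_gen ?R GF \<otimes>\<^bsub>?U\<^esub> pres_gen ?R GK)"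
      by (simp add: simps)
    have "?p (Poly_Mapping.single (replicate N GE) 1) = ?p 0"
      by (rule eq) (simp add: Uq_rels_def)
    then show "pres_gen ?R GE [^]\<^bsub>?U\<^esub> N = \<zero>\<^bsub>?U\<^esub>"
      by (simp add: simps zero)
    have "?p (Poly_Mapping.single (replicate N GF) 1) = ?p 0"
      by (rule eq) (simp add: Uq_rels_def)
    then show "pres_gen ?R GF [^]\<^bsub>?U\<^esub> N = \<zero>\<^bsub>?U\<^esub>"
      by (simp add: simps zero)
    define d where "d = 1 / (q - inverse q)"
    have "?p (Poly_Mapping.single [GE, GF] 1) = ?p (Poly_Mapping.single [GF, GE] 1 +
        (Poly_Mapping.single [GK] d + Poly_Mapping.single (replicate (N - 1) GK) (- d)))"
      by (rule eq) (simp add: Uq_rels_def d_def single_uminus diff_diff_eq)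
    then have "pres_gen ?R GE \<otimes>\<^bsub>?U\<^esub> pres_gen ?R GF = pres_gen ?R GF \<otimes>\<^bsub>?U\<^esub> pres_gen ?R GE \<oplus>\<^bsub>?U\<^esub>
      (d \<odot>\<^bsub>?U\<^esub> pres_gen ?R GK \<oplus>\<^bsub>?U\<^esub> (- d) \<odot>\<^bsub>?U\<^esub> pres_gen ?R GK [^]\<^bsub>?U\<^esub> (N - 1))"
      by (simp add: simps add)
    then show "pres_gen ?R GE \<otimes>\<^bsub>?U\<^esub> pres_gen ?R GF = pres_gen ?R GF \<otimes>\<^bsub>?U\<^esub> pres_gen ?R GE \<oplus>\<^bsub>?U\<^esub>
      ((1 / (q - inverse q)) \<odot>\<^bsub>?U\<^esub> pres_gen ?R GK \<oplus>\<^bsub>?U\<^esub> (- (1 / (q - inverse q))) \<odot>\<^bsub>?U\<^esub> pres_gen ?R GK [^]\<^bsub>?U\<^esub> (N - 1))"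
      by (simp only: d_def)
  qed
qed

lemma Uq_triple_scalar_algebra:
  assumes "0 < N"
  shows "Uq_triple scalar_algebra N q 1 0 (0 :: 'k::field)"
  by (intro Uq_triple.intro Uq_triple_axioms.intro kalgebra_scalar_algebra) (use assms in auto)

section \<open>The defining relations in the tensor square\<close>

context
  fixes N :: nat and q :: "'k::field"
  assumes N: "0 < N" and prim: "primitive_root_of_unity N (q ^ 2)"
begin

private abbreviation (input) "U \<equiv> Uq_alg N q"
private abbreviation (input) "K \<equiv> K\<^sub>q N q"
private abbreviation (input) "E \<equiv> E\<^sub>q N q"
private abbreviation (input) "F \<equiv> F\<^sub>q N q"
private abbreviation (input) "K' \<equiv> K\<^sub>q N q [^]\<^bsub>Uq_alg N q\<^esub> (N - 1)"
private abbreviation (input) "UU \<equiv> tensor_algebra (Uq_alg N q) (Uq_alg N q)"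
private abbreviation (input) "t \<equiv> tensor (Uq_alg N q) (Uq_alg N q)"

interpretation U: Uq_triple U N q K E F by (rule Uq_triple_Uq_alg)
interpretation T: kalgebra UU
  by (rule kalgebra_tensor_algebra[OF U.kalgebra_axioms U.kalgebra_axioms])

lemma q_nz: "q \<noteq> 0"
proof
  assume "q = 0"
  with prim N have "(0::'k) ^ N = 1" by (simp add: primitive_root_of_unity_def)
  with N show False by (simp add: power_0_left)
qed

lemma K_K': "K \<otimes>\<^bsub>U\<^esub> K' = \<one>\<^bsub>U\<^esub>" and K'_K: "K' \<otimes>\<^bsub>U\<^esub> K = \<one>\<^bsub>U\<^esub>"
proof -
  have "K [^]\<^bsub>U\<^esub> Suc (N - 1) = \<one>\<^bsub>U\<^esub>" using N U.k_pow by simp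
  then show "K \<otimes>\<^bsub>U\<^esub> K' = \<one>\<^bsub>U\<^esub>" "K' \<otimes>\<^bsub>U\<^esub> K = \<one>\<^bsub>U\<^esub>"
    by (simp_all add: U.pow_mult_self)
qed

lemma K'_E: "K' \<otimes>\<^bsub>U\<^esub> E = inverse (q ^ 2) \<odot>\<^bsub>U\<^esub> (E \<otimes>\<^bsub>U\<^esub> K')"
proof -
  \<comment> \<open>Inserting K' K = 1 on the left lets the relation between \<open>K\<close> and
    \<open>E\<close> act; solving for K' E gives the claim.\<close>
  have "E \<otimes>\<^bsub>U\<^esub> K' = (K' \<otimes>\<^bsub>U\<^esub> K) \<otimes>\<^bsub>U\<^esub> (E \<otimes>\<^bsub>U\<^esub> K')" by (simp add: K'_K)
  also have "\<dots> = K' \<otimes>\<^bsub>U\<^esub> ((K \<otimes>\<^bsub>U\<^esub> E) \<otimes>\<^bsub>U\<^esub> K')" by (simp add: U.m_assoc)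
  also have "\<dots> = q ^ 2 \<odot>\<^bsub>U\<^esub> (K' \<otimes>\<^bsub>U\<^esub> (E \<otimes>\<^bsub>U\<^esub> (K \<otimes>\<^bsub>U\<^esub> K')))" by (simp add: U.k_e U.m_assoc)
  finally show ?thesis using q_nz by (simp add: K_K')
qed

lemma K'_F: "K' \<otimes>\<^bsub>U\<^esub> F = q ^ 2 \<odot>\<^bsub>U\<^esub> (F \<otimes>\<^bsub>U\<^esub> K')"
proof -
  have "F \<otimes>\<^bsub>U\<^esub> K' = (K' \<otimes>\<^bsub>U\<^esub> K) \<otimes>\<^bsub>U\<^esub> (F \<otimes>\<^bsub>U\<^esub> K')" by (simp add: K'_K)
  also have "\<dots> = K' \<otimes>\<^bsub>U\<^esub> ((K \<otimes>\<^bsub>U\<^esub> F) \<otimes>\<^bsub>U\<^esub> K')" by (simp add: U.m_assoc)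
  also have "\<dots> = inverse (q ^ 2) \<odot>\<^bsub>U\<^esub> (K' \<otimes>\<^bsub>U\<^esub> (F \<otimes>\<^bsub>U\<^esub> (K \<otimes>\<^bsub>U\<^esub> K')))" by (simp add: U.k_f U.m_assoc)
  finally show ?thesis using q_nz by (simp add: K_K')
qed

lemma Uq_comult_gen_eq:
  "Uq_comult_gen N q GK = t K K"
  "Uq_comult_gen N q GE = t E K \<oplus>\<^bsub>UU\<^esub> t \<one>\<^bsub>U\<^esub> E"
  "Uq_comult_gen N q GF = t F \<one>\<^bsub>U\<^esub> \<oplus>\<^bsub>UU\<^esub> t K' F"
  by (simp_all add: Uq_comult_gen_def Let_def)

lemmas tensor_rules = tensor_closed[OF U.kalgebra_axioms U.kalgebra_axioms]
  tensor_mult[OF U.kalgebra_axioms U.kalgebra_axioms]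
  tensor_add_left[OF U.kalgebra_axioms U.kalgebra_axioms]
  tensor_add_right[OF U.kalgebra_axioms U.kalgebra_axioms]
  tensor_smult_left[OF U.kalgebra_axioms U.kalgebra_axioms]
  tensor_smult_right[OF U.kalgebra_axioms U.kalgebra_axioms]
  tensor_zero_left[OF U.kalgebra_axioms U.kalgebra_axioms]
  tensor_zero_right[OF U.kalgebra_axioms U.kalgebra_axioms]
  tensor_pow[OF U.kalgebra_axioms U.kalgebra_axioms]

text \<open>The two summands of \<Delta>(E), and likewise those of \<Delta>(F), commute up to q^2,
  so the N-th powers of the sums split and vanish. In the commutator of \<Delta>(E) and \<Delta>(F)
  the factors q^2 and q^-2 of the mixed terms cancel, and the two multiples of K' \<otimes> K are
  opposite.\<close>

lemma Uq_triple_comult: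
  "Uq_triple UU N q (Uq_comult_gen N q GK) (Uq_comult_gen N q GE) (Uq_comult_gen N q GF)"
  unfolding Uq_comult_gen_eq
proof (intro Uq_triple.intro Uq_triple_axioms.intro T.kalgebra_axioms)
  let ?d = "1 / (q - inverse q)"
  show "t K K [^]\<^bsub>UU\<^esub> N = \<one>\<^bsub>UU\<^esub>"
    by (simp add: tensor_rules U.k_pow tensor_one[OF U.kalgebra_axioms U.kalgebra_axioms])
  show "t K K \<otimes>\<^bsub>UU\<^esub> (t E K \<oplus>\<^bsub>UU\<^esub> t \<one>\<^bsub>U\<^esub> E) = q ^ 2 \<odot>\<^bsub>UU\<^esub> ((t E K \<oplus>\<^bsub>UU\<^esub> t \<one>\<^bsub>U\<^esub> E) \<otimes>\<^bsub>UU\<^esub> t K K)"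
    by (simp add: tensor_rules U.k_e T.l_distr T.r_distr T.smult_r_distr)
  show "t K K \<otimes>\<^bsub>UU\<^esub> (t F \<one>\<^bsub>U\<^esub> \<oplus>\<^bsub>UU\<^esub> t K' F) =
      inverse (q ^ 2) \<odot>\<^bsub>UU\<^esub> ((t F \<one>\<^bsub>U\<^esub> \<oplus>\<^bsub>UU\<^esub> t K' F) \<otimes>\<^bsub>UU\<^esub> t K K)"
    by (simp add: tensor_rules U.k_f T.l_distr T.r_distr T.smult_r_distr U.pow_mult_self)
  \<comment> \<open>Here 1 \<otimes> E has to play the role of \<open>Y\<close>: by K E = q^2 E K,
    the product (E \<otimes> K)(1 \<otimes> E) is q^2 times the reversed one.\<close>
  have "(t \<one>\<^bsub>U\<^esub> E \<oplus>\<^bsub>UU\<^esub> t E K) [^]\<^bsub>UU\<^esub> N = t \<one>\<^bsub>U\<^esub> E [^]\<^bsub>UU\<^esub> N \<oplus>\<^bsub>UU\<^esub> t E K [^]\<^bsub>UU\<^esub> N"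
    by (rule T.q_binomial_theorem_root_of_unity[OF _ _ _ prim]) (simp_all add: tensor_rules U.k_e)
  then show "(t E K \<oplus>\<^bsub>UU\<^esub> t \<one>\<^bsub>U\<^esub> E) [^]\<^bsub>UU\<^esub> N = \<zero>\<^bsub>UU\<^esub>"
    by (simp add: tensor_rules U.e_pow T.a_comm)
  have "(t F \<one>\<^bsub>U\<^esub> \<oplus>\<^bsub>UU\<^esub> t K' F) [^]\<^bsub>UU\<^esub> N = t F \<one>\<^bsub>U\<^esub> [^]\<^bsub>UU\<^esub> N \<oplus>\<^bsub>UU\<^esub> t K' F [^]\<^bsub>UU\<^esub> N"
    by (rule T.q_binomial_theorem_root_of_unity[OF _ _ _ prim]) (simp_all add: tensor_rules K'_F)
  then show "(t F \<one>\<^bsub>U\<^esub> \<oplus>\<^bsub>UU\<^esub> t K' F) [^]\<^bsub>UU\<^esub> N = \<zero>\<^bsub>UU\<^esub>"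
    by (simp add: tensor_rules U.f_pow)
  have "(t E K \<oplus>\<^bsub>UU\<^esub> t \<one>\<^bsub>U\<^esub> E) \<otimes>\<^bsub>UU\<^esub> (t F \<one>\<^bsub>U\<^esub> \<oplus>\<^bsub>UU\<^esub> t K' F) =
      (t (E \<otimes>\<^bsub>U\<^esub> F) K \<oplus>\<^bsub>UU\<^esub> t F E) \<oplus>\<^bsub>UU\<^esub> (t (E \<otimes>\<^bsub>U\<^esub> K') (K \<otimes>\<^bsub>U\<^esub> F) \<oplus>\<^bsub>UU\<^esub> t K' (E \<otimes>\<^bsub>U\<^esub> F))"
    by (simp add: tensor_rules T.l_distr T.r_distr)
  also have "\<dots> = ((t (F \<otimes>\<^bsub>U\<^esub> E) K \<oplus>\<^bsub>UU\<^esub> (?d \<odot>\<^bsub>UU\<^esub> t K K \<oplus>\<^bsub>UU\<^esub> (- ?d) \<odot>\<^bsub>UU\<^esub> t K' K)) \<oplus>\<^bsub>UU\<^esub> t F E)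
      \<oplus>\<^bsub>UU\<^esub> (t (K' \<otimes>\<^bsub>U\<^esub> E) (F \<otimes>\<^bsub>U\<^esub> K)
        \<oplus>\<^bsub>UU\<^esub> (t K' (F \<otimes>\<^bsub>U\<^esub> E) \<oplus>\<^bsub>UU\<^esub> (?d \<odot>\<^bsub>UU\<^esub> t K' K \<oplus>\<^bsub>UU\<^esub> (- ?d) \<odot>\<^bsub>UU\<^esub> t K' K')))"
    by (simp add: tensor_rules U.k_f K'_E U.e_f)
  also have "\<dots> = ((t (F \<otimes>\<^bsub>U\<^esub> E) K \<oplus>\<^bsub>UU\<^esub> t (K' \<otimes>\<^bsub>U\<^esub> E) (F \<otimes>\<^bsub>U\<^esub> K)) \<oplus>\<^bsub>UU\<^esub> (t F E \<oplus>\<^bsub>UU\<^esub> t K' (F \<otimes>\<^bsub>U\<^esub> E)))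
      \<oplus>\<^bsub>UU\<^esub> ((?d \<odot>\<^bsub>UU\<^esub> t K K \<oplus>\<^bsub>UU\<^esub> (- ?d) \<odot>\<^bsub>UU\<^esub> t K' K') \<oplus>\<^bsub>UU\<^esub> (?d \<odot>\<^bsub>UU\<^esub> t K' K \<oplus>\<^bsub>UU\<^esub> (- ?d) \<odot>\<^bsub>UU\<^esub> t K' K))"
    by (simp add: tensor_rules T.a_ac del: T.smult_smult)
  also have "?d \<odot>\<^bsub>UU\<^esub> t K' K \<oplus>\<^bsub>UU\<^esub> (- ?d) \<odot>\<^bsub>UU\<^esub> t K' K = \<zero>\<^bsub>UU\<^esub>"
    by (subst T.smult_l_distr[symmetric]) (simp_all add: tensor_rules)
  finally show "(t E K \<oplus>\<^bsub>UU\<^esub> t \<one>\<^bsub>U\<^esub> E) \<otimes>\<^bsub>UU\<^esub> (t F \<one>\<^bsub>U\<^esub> \<oplus>\<^bsub>UU\<^esub> t K' F) =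
      (t F \<one>\<^bsub>U\<^esub> \<oplus>\<^bsub>UU\<^esub> t K' F) \<otimes>\<^bsub>UU\<^esub> (t E K \<oplus>\<^bsub>UU\<^esub> t \<one>\<^bsub>U\<^esub> E) \<oplus>\<^bsub>UU\<^esub>
      (?d \<odot>\<^bsub>UU\<^esub> t K K \<oplus>\<^bsub>UU\<^esub> (- ?d) \<odot>\<^bsub>UU\<^esub> t K K [^]\<^bsub>UU\<^esub> (N - 1))"
    by (simp add: tensor_rules T.l_distr T.r_distr)
qed (simp_all add: tensor_rules)

lemmas kalgebra_hom_comult = kalgebra_hom_Uq_alg[OF Uq_triple_comult]
lemmas comult_gens = pres_lift_Uq[OF Uq_triple_comult, unfolded Uq_comult_gen_eq]

interpretation \<Delta>: kalgebra_hom U UU "pres_lift UU (Uq_comult_gen N q)"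
  by (rule kalgebra_hom_comult)

text \<open>Since K K' = 1, multiplying \<open>F\<close> by \<open>K\<close> gives it a coproduct of
  the same shape as that of \<open>E\<close>. This is why the generator contains a multiple of K F
  and not of \<open>F\<close>.\<close>

lemma comult_KF:
  "pres_lift UU (Uq_comult_gen N q) (K \<otimes>\<^bsub>U\<^esub> F) = t (K \<otimes>\<^bsub>U\<^esub> F) K \<oplus>\<^bsub>UU\<^esub> t \<one>\<^bsub>U\<^esub> (K \<otimes>\<^bsub>U\<^esub> F)"
  by (simp add: comult_gens tensor_rules T.r_distr K_K')

lemma comult_in_tensor_subspace:
  fixes a b
  defines "u \<equiv> E \<oplus>\<^bsub>U\<^esub> a \<odot>\<^bsub>U\<^esub> (K \<otimes>\<^bsub>U\<^esub> F) \<oplus>\<^bsub>U\<^esub> b \<odot>\<^bsub>U\<^esub> K"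
  assumes "x \<in> gen_subalgebra U {u}"
  shows "pres_lift UU (Uq_comult_gen N q) x \<in> tensor_subspace U U (gen_subalgebra U {u}) (carrier U)"
proof -
  let ?\<Delta> = "pres_lift UU (Uq_comult_gen N q)"
  have u: "u \<in> carrier U" by (simp add: u_def)
  let ?A = "gen_subalgebra U {u}"
  note A = U.gen_subalgebra_singleton[OF u]
  have sub: "is_subalgebra U ?A" unfolding A by (rule U.subalgebra_range_poly_eval[OF u])
  have carrier: "is_subalgebra U (carrier U)"
    by (simp add: is_subalgebra_def U.carrier_is_subring)
  let ?W = "tensor_subspace U U ?A (carrier U)"
  have W: "is_subalgebra UU ?W"
    by (rule subalgebra_tensor_subspace[OF U.kalgebra_axioms U.kalgebra_axioms sub carrier])
  have "u \<in> ?A" by (auto simp: gen_subalgebra_def)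
  moreover have "\<one>\<^bsub>U\<^esub> \<in> ?A"
    using sub subringE(3) by (auto simp: is_subalgebra_def)
  \<comment> \<open>The term b K \<otimes> K is absorbed by u \<otimes> K, so the only left factors
    are \<open>u\<close> and 1, both in the subalgebra.\<close>
  moreover have "?\<Delta> u = t u K \<oplus>\<^bsub>UU\<^esub> t \<one>\<^bsub>U\<^esub> (E \<oplus>\<^bsub>U\<^esub> a \<odot>\<^bsub>U\<^esub> (K \<otimes>\<^bsub>U\<^esub> F))"
  proof -
    have "?\<Delta> u = ?\<Delta> E \<oplus>\<^bsub>UU\<^esub> a \<odot>\<^bsub>UU\<^esub> ?\<Delta> (K \<otimes>\<^bsub>U\<^esub> F) \<oplus>\<^bsub>UU\<^esub> b \<odot>\<^bsub>UU\<^esub> ?\<Delta> K"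
      unfolding u_def by (simp del: \<Delta>.mult)
    then show ?thesis unfolding comult_KF comult_gens u_def
      by (simp add: tensor_rules T.smult_r_distr T.a_ac)
  qed
  moreover have "subring ?W UU" using W by (simp add: is_subalgebra_def)
  ultimately have \<Delta>u: "?\<Delta> u \<in> ?W"
    by (auto intro!: subringE(7) tensor_in_subspace[OF U.kalgebra_axioms U.kalgebra_axioms] U.a_closed U.smult_closed U.m_closed)
  \<comment> \<open>As \<Delta>(p(u)) = p(\<Delta>(u)), membership of \<Delta>(u) in the subalgebra
    \<open>?W\<close> passes to every polynomial in \<open>u\<close>.\<close>
  have "gen_subalgebra UU {?\<Delta> u} \<subseteq> ?W" using W \<Delta>u by (auto simp: gen_subalgebra_def)
  moreover have "gen_subalgebra UU {?\<Delta> u} = range (poly_eval UU (?\<Delta> u))"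
    by (rule T.gen_subalgebra_singleton) (rule \<Delta>.closed[OF u])
  moreover have "?\<Delta> (poly_eval U u p) = poly_eval UU (?\<Delta> u) p" for p
    by (induction p) (use u in auto)
  ultimately show ?thesis using assms(2) A by auto
qed

end

section \<open>A baby Verma module\<close>

definition linear_endos :: "('k::field, ('i \<Rightarrow> 'k) \<Rightarrow> ('i \<Rightarrow> 'k)) module" where
  "linear_endos =
    \<lparr>carrier = {S. (\<forall>f g. S (\<lambda>i. f i + g i) = (\<lambda>i. S f i + S g i)) \<and>
                  (\<forall>c f. S (\<lambda>i. c * f i) = (\<lambda>i. c * S f i))},
     monoid.mult = (\<circ>), one = id, zero = (\<lambda>_ _. 0), add = (\<lambda>S S' f i. S f i + S' f i),
     module.smult = (\<lambda>c S f i. c * S f i)\<rparr>"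

lemma linear_endos_simps [simp]:
  "S \<otimes>\<^bsub>linear_endos\<^esub> S' = S \<circ> S'" "\<one>\<^bsub>linear_endos\<^esub> = id" "\<zero>\<^bsub>linear_endos\<^esub> = (\<lambda>_ _. 0)"
  "S \<oplus>\<^bsub>linear_endos\<^esub> S' = (\<lambda>f i. S f i + S' f i)" "c \<odot>\<^bsub>linear_endos\<^esub> S = (\<lambda>f i. c * S f i)"
  by (simp_all add: linear_endos_def)

lemma kalgebra_linear_endos: "kalgebra (linear_endos :: ('k::field, ('i \<Rightarrow> 'k) \<Rightarrow> _) module)"
proof (intro kalgebraI ringI abelian_groupI monoidI)
  fix S :: "('i \<Rightarrow> 'k) \<Rightarrow> 'i \<Rightarrow> 'k" assume S: "S \<in> carrier linear_endos"
  show "\<exists>S'\<in>carrier linear_endos. S' \<oplus>\<^bsub>linear_endos\<^esub> S = \<zero>\<^bsub>linear_endos\<^esub>"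
    by (rule bexI[of _ "\<lambda>f i. - S f i"]) (use S in \<open>auto simp: linear_endos_def\<close>)
next
  fix S S' :: "('i \<Rightarrow> 'k) \<Rightarrow> 'i \<Rightarrow> 'k"
  assume "S \<in> carrier linear_endos" "S' \<in> carrier linear_endos"
  then show "S \<otimes>\<^bsub>linear_endos\<^esub> S' \<in> carrier linear_endos"
    by (simp add: linear_endos_def)
qed (auto simp: linear_endos_def algebra_simps fun_eq_iff)

lemma linear_endos_pow [simp]: "S [^]\<^bsub>linear_endos\<^esub> (n::nat) = S ^^ n"
  by (induction n) (simp_all add: nat_pow_def funpow_Suc_right del: funpow.simps(2))

text \<open>
  The functions supported on \<open>{..<N}\<close> form a baby Verma module. Acting on all functions on the
  naturals, with period \<open>N\<close>, avoids a case distinction at the upper end.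
\<close>

definition verma_K :: "'k::field \<Rightarrow> (nat \<Rightarrow> 'k) \<Rightarrow> nat \<Rightarrow> 'k" where
  "verma_K q f i = inverse (q ^ 2) ^ i * f i"

text \<open>With v_i = F^i v_0 and K v_0 = v_0, the commutator relation forces E v_i to be this
  multiple of v_(i-1): the summand for \<open>l\<close> is the eigenvalue of (K - K^-1)/(q - q^-1)
  on v_l.\<close>

definition verma_coeff :: "'k::field \<Rightarrow> nat \<Rightarrow> 'k" where
  "verma_coeff q i = (\<Sum>l<i. (inverse (q ^ 2) ^ l - (q ^ 2) ^ l) / (q - inverse q))"

definition verma_E :: "'k::field \<Rightarrow> (nat \<Rightarrow> 'k) \<Rightarrow> nat \<Rightarrow> 'k" where
  "verma_E q f i = verma_coeff q (Suc i) * f (Suc i)"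

text \<open>The value of a function at i is its coordinate at v_i. The cut at multiples of N
  expresses F v_(N-1) = 0 in each block, and it also catches i = 0, where \<open>i - 1\<close> is no
  predecessor.\<close>

definition verma_F :: "nat \<Rightarrow> (nat \<Rightarrow> 'k::field) \<Rightarrow> nat \<Rightarrow> 'k" where
  "verma_F N f i = (if N dvd i then 0 else f (i - 1))"

context
  fixes N :: nat and q :: "'k::field"
  assumes N: "1 < N" and prim: "primitive_root_of_unity N (q ^ 2)"
begin

lemma Q_pow: "(q ^ 2) ^ N = 1"
  using prim by (simp add: primitive_root_of_unity_def)

lemma Q_neq_1: "q ^ 2 \<noteq> 1"
  using primitive_root_power_ne_1[OF prim, of 1] N by simp

lemma q_neq_0: "q \<noteq> 0"
  using q_nz[OF _ prim] N by simp

text \<open>Both parts are geometric sums over whole periods of a root of unity other than 1. Hence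
  \<open>E\<close> does not cross the boundary between two blocks either.\<close>

lemma verma_coeff_dvd: "N dvd i \<Longrightarrow> verma_coeff q i = 0"
proof -
  assume "N dvd i"
  then obtain m where m: "i = N * m" by auto
  have "(\<Sum>l<i. x ^ l) = 0" if "x \<noteq> 1" "x ^ N = 1" for x :: 'k
    using that by (simp add: geometric_sum m power_mult)
  from this[of "q ^ 2"] this[of "inverse (q ^ 2)"]
  show ?thesis using Q_pow Q_neq_1 q_neq_0
    by (simp add: verma_coeff_def sum_divide_distrib[symmetric] sum_subtractf power_inverse inverse_eq_1_iff del: inverse_eq_divide)
qed

text \<open>The value at \<open>i\<close> carries the coefficients with indices i + 1 to i + n,
  among them the vanishing one at \<open>j\<close>.\<close>

lemma verma_E_pow:
  "\<lbrakk>i < j; j \<le> i + n; N dvd j\<rbrakk> \<Longrightarrow> (verma_E q ^^ n) f i = 0"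
proof (induction n arbitrary: i)
  case (Suc n)
  show ?case
  proof (cases "j = Suc i")
    case True
    then show ?thesis using Suc.prems verma_coeff_dvd[of "Suc i"] by (simp add: verma_E_def)
  next
    case False
    then show ?thesis using Suc.prems Suc.IH[of "Suc i"] by (simp add: verma_E_def)
  qed
qed auto

text \<open>Going down \<open>n\<close> steps from \<open>i\<close> passes the multiple
  \<open>j\<close>, where \<open>F\<close> cuts off.\<close>

lemma verma_F_pow:
  "\<lbrakk>j \<le> i; i < j + n; N dvd j\<rbrakk> \<Longrightarrow> (verma_F N ^^ n) f i = 0"
proof (induction n arbitrary: i)
  case (Suc n)
  show ?case
  proof (cases "N dvd i")
    case False
    then have "j \<noteq> i" using Suc.prems by auto
    then show ?thesis using Suc.prems Suc.IH[of "i - 1"] by (simp add: verma_F_def)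
  qed (simp add: verma_F_def)
qed auto

lemma verma_K_pow: "(verma_K q ^^ n) f i = (inverse (q ^ 2) ^ i) ^ n * f i"
  by (induction n) (simp_all add: verma_K_def)

lemma Uq_triple_verma: "Uq_triple linear_endos N q (verma_K q) (verma_E q) (verma_F N)"
proof (intro Uq_triple.intro Uq_triple_axioms.intro kalgebra_linear_endos)
  have Kp: "(inverse (q ^ 2) ^ i) ^ N = 1" for i
    by (metis Q_pow mult.commute power_inverse power_mult power_one inverse_1)
  show "verma_K q [^]\<^bsub>linear_endos\<^esub> N = \<one>\<^bsub>linear_endos\<^esub>"
    by (auto simp: verma_K_pow fun_eq_iff Kp simp del: inverse_eq_divide)
  have K': "(verma_K q ^^ (N - 1)) f i = (q ^ 2) ^ i * f i" for f i
  proof -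
    have "(inverse (q ^ 2) ^ i) ^ Suc (N - 1) = 1" using Kp[of i] N by simp
    then have "(inverse (q ^ 2) ^ i) ^ (N - 1) = (q ^ 2) ^ i"
      using q_neq_0 by (simp add: field_simps)
    then show ?thesis by (simp add: verma_K_pow)
  qed
  show "verma_K q \<otimes>\<^bsub>linear_endos\<^esub> verma_E q = q ^ 2 \<odot>\<^bsub>linear_endos\<^esub> (verma_E q \<otimes>\<^bsub>linear_endos\<^esub> verma_K q)"
    using q_neq_0 by (auto simp: verma_K_def verma_E_def fun_eq_iff)
  show "verma_K q \<otimes>\<^bsub>linear_endos\<^esub> verma_F N = inverse (q ^ 2) \<odot>\<^bsub>linear_endos\<^esub> (verma_F N \<otimes>\<^bsub>linear_endos\<^esub> verma_K q)"
  proof -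
    have "inverse (q ^ 2) ^ i = inverse (q ^ 2) * inverse (q ^ 2) ^ (i - 1)" if "\<not> N dvd i" for i
      using that by (cases i) auto
    then show ?thesis by (auto simp: verma_K_def verma_F_def fun_eq_iff simp del: power_inverse inverse_eq_divide)
  qed
  show "verma_E q [^]\<^bsub>linear_endos\<^esub> N = \<zero>\<^bsub>linear_endos\<^esub>"
  proof -
    have "(verma_E q ^^ N) f i = 0" for f i
    proof (rule verma_E_pow)
      show "i < N * (i div N) + N" "N * (i div N) + N \<le> i + N"
        using N mod_less_divisor[of N i] mult_div_mod_eq[of N i] by linarith+
    qed simp
    then show ?thesis by (simp add: fun_eq_iff)
  qed
  show "(verma_F N :: (nat \<Rightarrow> 'k) \<Rightarrow> _) [^]\<^bsub>linear_endos\<^esub> N = \<zero>\<^bsub>linear_endos\<^esub>"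
  proof -
    have "(verma_F N ^^ N) f i = 0" for f :: "nat \<Rightarrow> 'k" and i
    proof (rule verma_F_pow)
      show "N * (i div N) \<le> i" "i < N * (i div N) + N"
        using N mod_less_divisor[of N i] mult_div_mod_eq[of N i] by linarith+
    qed simp
    then show ?thesis by (simp add: fun_eq_iff)
  qed
  let ?d = "1 / (q - inverse q)"
  have "(verma_E q \<circ> verma_F N) f i = (verma_F N \<circ> verma_E q) f i
      + (?d * verma_K q f i + (- ?d) * (verma_K q ^^ (N - 1)) f i)" for f i
  proof -
    \<comment> \<open>This holds at a block boundary too: if N divides i + 1, then \<open>F\<close>
      gives 0, but so does the coefficient.\<close>
    have "(verma_E q \<circ> verma_F N) f i = verma_coeff q (Suc i) * f i"
      using verma_coeff_dvd[of "Suc i"] by (simp add: verma_E_def verma_F_def)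
    moreover have "(verma_F N \<circ> verma_E q) f i = verma_coeff q i * f i"
    proof (cases "N dvd i")
      case False
      then show ?thesis by (cases i) (simp_all add: verma_E_def verma_F_def)
    qed (simp add: verma_coeff_dvd verma_F_def)
    moreover have "verma_coeff q (Suc i) = verma_coeff q i + ?d * (inverse (q ^ 2) ^ i - (q ^ 2) ^ i)"
      by (simp add: verma_coeff_def)
    moreover have "(c + d * (x - y)) * z = c * z + (d * (x * z) + (- d) * (y * z))" for c d x y z :: 'k
      by (simp add: algebra_simps)
    ultimately show ?thesis unfolding K' verma_K_def by (simp only:)
  qed
  then show "verma_E q \<otimes>\<^bsub>linear_endos\<^esub> verma_F N = verma_F N \<otimes>\<^bsub>linear_endos\<^esub> verma_E q \<oplus>\<^bsub>linear_endos\<^esub>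
      (?d \<odot>\<^bsub>linear_endos\<^esub> verma_K q \<oplus>\<^bsub>linear_endos\<^esub> (- ?d) \<odot>\<^bsub>linear_endos\<^esub> verma_K q [^]\<^bsub>linear_endos\<^esub> (N - 1))"
    by (simp add: fun_eq_iff)
qed (auto simp: linear_endos_def verma_K_def verma_E_def verma_F_def fun_eq_iff algebra_simps)

interpretation V: Uq_triple linear_endos N q "verma_K q" "verma_E q" "verma_F N"
  by (rule Uq_triple_verma)

text \<open>\<open>E\<close> lowers the index, \<open>K\<close> keeps it, and K F raises it by one
  with a nonzero factor. Starting from v_0, each multiplication by \<open>u\<close> thus moves the
  top index up by exactly one as long as it stays below N; Horner's scheme matches the
  \<open>pCons\<close> induction.\<close>

lemma poly_eval_verma:
  fixes a b
  defines "u \<equiv> verma_E q \<oplus>\<^bsub>linear_endos\<^esub> a \<odot>\<^bsub>linear_endos\<^esub> (verma_K q \<otimes>\<^bsub>linear_endos\<^esub> verma_F N)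
      \<oplus>\<^bsub>linear_endos\<^esub> b \<odot>\<^bsub>linear_endos\<^esub> verma_K q"
  assumes "a \<noteq> 0"
  shows "\<lbrakk>p \<noteq> 0; degree p < N\<rbrakk> \<Longrightarrow>
    poly_eval linear_endos u p (\<lambda>i. of_bool (i = 0)) (degree p) \<noteq> 0 \<and>
    (\<forall>i > degree p. poly_eval linear_endos u p (\<lambda>i. of_bool (i = 0)) i = 0)"
proof (induction p)
  case (pCons c p)
  have u: "u \<in> carrier linear_endos" unfolding u_def by (simp del: linear_endos_simps)
  have u_app: "u f i = verma_coeff q (Suc i) * f (Suc i)
      + a * (inverse (q ^ 2) ^ i * (if N dvd i then 0 else f (i - 1)))
      + b * (inverse (q ^ 2) ^ i * f i)" for f i
    by (simp add: u_def verma_E_def verma_F_def verma_K_def)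
  define v where "v = poly_eval linear_endos u p (\<lambda>i. of_bool (i = 0))"
  have ev: "poly_eval linear_endos u (pCons c p) (\<lambda>i. of_bool (i = 0)) i = c * of_bool (i = 0) + u v i" for i
    using u by (simp add: V.poly_eval_pCons v_def)
  show ?case
  proof (cases "p = 0")
    case True
    then have "v i = 0" for i using u by (simp add: v_def V.poly_eval_0)
    then show ?thesis unfolding ev u_app[of v] using True pCons.hyps by simp
  next
    case False
    have deg: "degree (pCons c p) = Suc (degree p)" using False by simp
    have v: "v (degree p) \<noteq> 0" "v i = 0" if "degree p < i" for i
      using pCons.IH[OF False] pCons.prems deg that by (auto simp: v_def)
    \<comment> \<open>The new top index is positive and below N, so \<open>F\<close> is not cut off
      there.\<close>
    have ndvd: "\<not> N dvd Suc (degree p)"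
      using pCons.prems(2) deg by (auto dest: dvd_imp_le)
    show ?thesis unfolding ev deg u_app[of v]
      using v ndvd assms(2) q_neq_0 by auto
  qed
qed simp

lemma poly_eval_Uq_neq_0:
  fixes a b
  defines "u \<equiv> E\<^sub>q N q \<oplus>\<^bsub>Uq_alg N q\<^esub> a \<odot>\<^bsub>Uq_alg N q\<^esub> (K\<^sub>q N q \<otimes>\<^bsub>Uq_alg N q\<^esub> F\<^sub>q N q)
      \<oplus>\<^bsub>Uq_alg N q\<^esub> b \<odot>\<^bsub>Uq_alg N q\<^esub> K\<^sub>q N q"
  assumes "a \<noteq> 0" "p \<noteq> 0" "degree p < N"
  shows "poly_eval (Uq_alg N q) u p \<noteq> \<zero>\<^bsub>Uq_alg N q\<^esub>"
proof
  interpret U: Uq_triple "Uq_alg N q" N q "K\<^sub>q N q" "E\<^sub>q N q" "F\<^sub>q N q" by (rule Uq_triple_Uq_alg)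
  define h where "h = case_gen (verma_K q) (verma_E q) (verma_F N :: (nat \<Rightarrow> 'k) \<Rightarrow> _)"
  have h: "Uq_triple linear_endos N q (h GK) (h GE) (h GF)"
    unfolding h_def using Uq_triple_verma by simp
  interpret \<rho>: kalgebra_hom "Uq_alg N q" linear_endos "pres_lift linear_endos h"
    by (rule kalgebra_hom_Uq_alg[OF h])
  let ?v = "verma_E q \<oplus>\<^bsub>linear_endos\<^esub> a \<odot>\<^bsub>linear_endos\<^esub> (verma_K q \<otimes>\<^bsub>linear_endos\<^esub> verma_F N)
      \<oplus>\<^bsub>linear_endos\<^esub> b \<odot>\<^bsub>linear_endos\<^esub> verma_K q"
  have u: "u \<in> carrier (Uq_alg N q)" by (simp add: u_def)
  have "pres_lift linear_endos h u = ?v"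
    unfolding u_def by (simp add: pres_lift_Uq[OF h] del: linear_endos_simps) (simp add: h_def)
  then have ev: "pres_lift linear_endos h (poly_eval (Uq_alg N q) u p) = poly_eval linear_endos ?v p" for p
    by (induction p) (use u in \<open>auto simp del: linear_endos_simps\<close>)
  assume "poly_eval (Uq_alg N q) u p = \<zero>\<^bsub>Uq_alg N q\<^esub>"
  then have "poly_eval linear_endos ?v p = \<zero>\<^bsub>linear_endos\<^esub>"
    using ev[of p] by (simp del: linear_endos_simps)
  with poly_eval_verma[OF assms(2,3,4), of b] show False by simp
qed

end

section \<open>The minimal polynomial\<close>

lemma poly_eval_scalar_algebra: "poly_eval scalar_algebra x p = poly p x"
proof -
  interpret kalgebra scalar_algebra by (rule kalgebra_scalar_algebra)
  show ?thesis by (induction p) simp_all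
qed

text \<open>Commuting scalars with s s' = c satisfy s' s = Q s s' + (1 - Q) c, so they form an
  oscillator pair in the algebra of scalars.\<close>

lemma poly_q_hermite_root_of_unity:
  assumes "primitive_root_of_unity N Q" "s * s' = c"
  shows "poly (q_hermite Q c N) (s + s') = s ^ N + s' ^ N"
proof -
  interpret kalgebra scalar_algebra by (rule kalgebra_scalar_algebra)
  show ?thesis
    using poly_eval_q_hermite_root_of_unity[of s s' Q c N] assms
    by (simp add: poly_eval_scalar_algebra algebra_simps)
qed

text \<open>
  The polynomial with \<open>p (\<sigma> (t + 1/t)) = \<sigma>\<^sup>n (t\<^sup>n + t\<^bsup>n-1\<^esup> + \<dots> + t\<^bsup>-n\<^esup>)\<close>, a rescaled Chebyshev
  polynomial of the fourth kind.
\<close>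

fun chebyshev_W :: "'k::field \<Rightarrow> nat \<Rightarrow> 'k poly" where
  "chebyshev_W \<sigma> 0 = 1"
| "chebyshev_W \<sigma> (Suc 0) = [:\<sigma>, 1:]"
| "chebyshev_W \<sigma> (Suc (Suc n)) =
    [:0, 1:] * chebyshev_W \<sigma> (Suc n) - Polynomial.smult (\<sigma> ^ 2) (chebyshev_W \<sigma> n)"

lemma degree_chebyshev_W: "degree (chebyshev_W \<sigma> n) \<le> n"
proof (induction \<sigma> n rule: chebyshev_W.induct)
  case (3 \<sigma> n)
  have "degree ([:0, 1:] * chebyshev_W \<sigma> (Suc n)) \<le> Suc (Suc n)"
    using degree_mult_le[of "[:0, 1:]" "chebyshev_W \<sigma> (Suc n)"] 3 by simp
  moreover have "degree (Polynomial.smult (\<sigma> ^ 2) (chebyshev_W \<sigma> n)) \<le> Suc (Suc n)"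
    using degree_smult_le[of "\<sigma> ^ 2" "chebyshev_W \<sigma> n"] 3 by simp
  ultimately show ?case unfolding chebyshev_W.simps by (rule degree_diff_le)
qed auto

text \<open>At t = 1 the sum of powers of t consists of 2n + 1 ones. The recursion is used because
  the closed form \<open>poly_chebyshev_W\<close> degenerates to 0 = 0 at that point.\<close>

lemma poly_chebyshev_W_double: "poly (chebyshev_W \<sigma> n) (2 * \<sigma>) = \<sigma> ^ n * of_nat (2 * n + 1)"
  by (induction \<sigma> n rule: chebyshev_W.induct) (auto simp: algebra_simps power2_eq_square)

text \<open>The factor (t - 1) t^n turns the sum of powers of t into a closed form; the denominators
  are cleared through x t = \<sigma>(t^2 + 1).\<close>

lemma poly_chebyshev_W:
  assumes "t \<noteq> 0"
  shows "poly (chebyshev_W \<sigma> n) (\<sigma> * (t + 1 / t)) * ((t - 1) * t ^ n) = \<sigma> ^ n * (t ^ (2 * n + 1) - 1)"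
proof (induction \<sigma> n rule: chebyshev_W.induct)
  case (2 \<sigma>)
  define x where "x = \<sigma> * (t + 1 / t)"
  have xt: "x * t = \<sigma> * (t ^ 2 + 1)"
    using assms by (simp add: x_def field_simps power2_eq_square)
  have "(\<sigma> + x) * ((t - 1) * t) = (\<sigma> * t + x * t) * (t - 1)"
    by (simp add: algebra_simps)
  also have "\<dots> = \<sigma> * (t ^ 3 - 1)"
    unfolding xt by (simp add: algebra_simps power2_eq_square power3_eq_cube)
  finally show ?case by (simp add: x_def numeral_3_eq_3)
next
  case (3 \<sigma> n)
  define x where "x = \<sigma> * (t + 1 / t)"
  have xt: "x * t = \<sigma> * (t ^ 2 + 1)"
    using assms by (simp add: x_def field_simps power2_eq_square)
  let ?W = "\<lambda>n. poly (chebyshev_W \<sigma> n) x"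
  define T where "T = t ^ (2 * n + 1)"
  have T: "t ^ (2 * Suc n + 1) = t ^ 2 * T" "t ^ (2 * Suc (Suc n) + 1) = t ^ 2 * (t ^ 2 * T)"
    by (simp_all add: T_def power_add power2_eq_square)
  have "?W (Suc (Suc n)) * ((t - 1) * t ^ Suc (Suc n)) =
      (x * t) * (?W (Suc n) * ((t - 1) * t ^ Suc n)) - \<sigma> ^ 2 * t ^ 2 * (?W n * ((t - 1) * t ^ n))"
    by (simp add: algebra_simps power2_eq_square)
  also have "\<dots> = \<sigma> * (t ^ 2 + 1) * (\<sigma> ^ Suc n * (t ^ 2 * T - 1)) - \<sigma> ^ 2 * t ^ 2 * (\<sigma> ^ n * (T - 1))"
    unfolding xt 3[folded x_def] T T_def[symmetric] ..
  also have "\<dots> = \<sigma> ^ Suc (Suc n) * (t ^ (2 * Suc (Suc n) + 1) - 1)"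
    unfolding T by (simp add: algebra_simps power2_eq_square)
  finally show ?case unfolding x_def .
qed auto

text \<open>After multiplication by t^N both sides become \<sigma>^N (t^N - 1)^2. On the right, x -
  2\<sigma> accounts for the factor (t - 1)^2 and W^2 for the square of the cofactor.\<close>

lemma q_hermite_factorization:
  fixes Q \<sigma> :: "'k :: {alg_closed_field, field_char_0}"
  assumes prim: "primitive_root_of_unity N Q" and N: "N = 2 * m + 1" and \<sigma>: "\<sigma> \<noteq> 0"
  shows "q_hermite Q (\<sigma> ^ 2) N - [:2 * \<sigma> ^ N:] = [:- (2 * \<sigma>), 1:] * chebyshev_W \<sigma> m ^ 2"
proof -
  let ?W = "chebyshev_W \<sigma> m"
  have "poly (q_hermite Q (\<sigma> ^ 2) N - [:2 * \<sigma> ^ N:]) x = poly ([:- (2 * \<sigma>), 1:] * ?W ^ 2) x" for x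
  proof -
    \<comment> \<open>Every x has the form \<sigma>(t + 1/t): t solves t^2 - (x/\<sigma>) t + 1 = 0,
      whose constant term keeps it away from 0.\<close>
    obtain t where "poly [:1, - (x / \<sigma>), 1:] t = 0"
      using alg_closed_imp_poly_has_root[of "[:1, - (x / \<sigma>), 1:]"] by auto
    then have t: "t ^ 2 - (x / \<sigma>) * t + 1 = 0"
      by (simp add: algebra_simps power2_eq_square)
    have t0: "t \<noteq> 0" using t by auto
    have x: "x = \<sigma> * (t + 1 / t)"
      using t t0 \<sigma> by (simp add: field_simps power2_eq_square)
    have "poly (q_hermite Q (\<sigma> ^ 2) N) (\<sigma> * t + \<sigma> / t) = (\<sigma> * t) ^ N + (\<sigma> / t) ^ N"
      using t0 by (intro poly_q_hermite_root_of_unity[OF prim]) (simp add: power2_eq_square)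
    then have "poly (q_hermite Q (\<sigma> ^ 2) N - [:2 * \<sigma> ^ N:]) x * t ^ N =
        ((\<sigma> * t) ^ N + (\<sigma> / t) ^ N - 2 * \<sigma> ^ N) * t ^ N"
      by (simp add: x algebra_simps)
    also have "\<dots> = \<sigma> ^ N * (t ^ N - 1) ^ 2"
      using t0 by (simp add: power_mult_distrib power_divide field_simps power2_eq_square)
    also have "\<dots> = \<sigma> * (\<sigma> ^ m * (t ^ (2 * m + 1) - 1)) ^ 2"
      by (simp add: N power_add power_mult_distrib power_mult[symmetric] mult.commute)
    also have "\<dots> = \<sigma> * (poly ?W x * ((t - 1) * t ^ m)) ^ 2"
      unfolding poly_chebyshev_W[OF t0, of \<sigma> m, folded x] ..
    also have "\<dots> = (x - 2 * \<sigma>) * poly ?W x ^ 2 * t ^ N"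
    proof -
      have "(x - 2 * \<sigma>) * t = \<sigma> * (t - 1) ^ 2"
        using t0 by (simp add: x field_simps power2_eq_square)
      then have "\<sigma> * (poly ?W x * ((t - 1) * t ^ m)) ^ 2 =
          ((x - 2 * \<sigma>) * t) * (poly ?W x ^ 2 * (t ^ m) ^ 2)"
        by (simp add: power_mult_distrib mult_ac)
      moreover have "t ^ N = t * (t ^ m) ^ 2"
        by (simp add: N power_add power_mult[symmetric] mult.commute)
      ultimately show ?thesis by (simp only: mult_ac)
    qed
    finally have "poly (q_hermite Q (\<sigma> ^ 2) N - [:2 * \<sigma> ^ N:]) x = (x - 2 * \<sigma>) * poly ?W x ^ 2"
      using t0 by (simp only: mult_right_cancel power_eq_0_iff simp_thms)
    also have "\<dots> = poly ([:- (2 * \<sigma>), 1:] * ?W ^ 2) x"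
      by (simp add: algebra_simps)
    finally show ?thesis .
  qed
  \<comment> \<open>A field of characteristic zero is infinite, so agreement at all points is
    equality of polynomials.\<close>
  then show ?thesis unfolding poly_eq_poly_eq_iff[symmetric] by auto
qed

text \<open>The ideal I generated by p(u) has square zero. If 1 = i + j with i in I and j in a
  complement J, then i j lies in both, by commutativity, so i = i^2 + i j = 0. Thus J contains 1 and
  hence all of I, contradicting p(u) \<noteq> 0.\<close>

lemma (in kalgebra) not_semisimple_gen_subalgebra:
  assumes u: "u \<in> carrier R" and p: "poly_eval R u p \<noteq> \<zero>" and p2: "poly_eval R u (p * p) = \<zero>"
  shows "\<not> semisimple_ring (R\<lparr>carrier := gen_subalgebra R {u}\<rparr>)"
proof
  let ?ev = "poly_eval R u" and ?R' = "R\<lparr>carrier := gen_subalgebra R {u}\<rparr>"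
  note A = gen_subalgebra_singleton[OF u]
  have "subring (gen_subalgebra R {u}) R"
    using subalgebra_range_poly_eval[OF u] by (simp add: A is_subalgebra_def)
  then interpret R': ring ?R' by (rule subring_is_ring)
  let ?I = "range (\<lambda>r. ?ev (p * r))"
  have "is_left_ideal ?I ?R'"
    unfolding is_left_ideal_def
  proof (intro conjI ballI additive_subgroupI R'.add.subgroupI)
    fix x assume "x \<in> ?I"
    then obtain r where x: "x = ?ev (p * r)" by auto
    have "?ev (p * - r) \<oplus> ?ev (p * r) = \<zero>"
      using u by (simp flip: poly_eval_add add: algebra_simps del: poly_eval_mult)
    then have "\<ominus>\<^bsub>?R'\<^esub> x = ?ev (p * - r)"
      unfolding x by (intro R'.minus_equality) (auto simp: A simp del: poly_eval_mult)
    then show "\<ominus>\<^bsub>?R'\<^esub> x \<in> ?I" by (rule range_eqI[of _ _ "- r"])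
  next
    fix x y assume "x \<in> ?I" "y \<in> ?I"
    then obtain r s where "x = ?ev (p * r)" "y = ?ev (p * s)" by auto
    then have "x \<oplus>\<^bsub>?R'\<^esub> y = ?ev (p * (r + s))"
      using u by (simp add: distrib_left del: poly_eval_mult)
    then show "x \<oplus>\<^bsub>?R'\<^esub> y \<in> ?I" by (rule range_eqI[of _ _ "r + s"])
  next
    fix a x assume "a \<in> carrier ?R'" "x \<in> ?I"
    then obtain r s where "a = ?ev r" "x = ?ev (p * s)" by (auto simp: A)
    then have "a \<otimes>\<^bsub>?R'\<^esub> x = ?ev (p * (r * s))"
      using u by (simp flip: poly_eval_mult add: mult_ac)
    then show "a \<otimes>\<^bsub>?R'\<^esub> x \<in> ?I" by (rule range_eqI[of _ _ "r * s"])
  qed (auto simp: A)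
  moreover assume "semisimple_ring ?R'"
  ultimately obtain J where J: "is_left_ideal J ?R'" "?I \<inter> J = {\<zero>\<^bsub>?R'\<^esub>}" "?I <+>\<^bsub>?R'\<^esub> J = carrier ?R'"
    unfolding semisimple_ring_def by blast
  have I_J: "x = \<zero>" if "x \<in> ?I" "x \<in> J" for x
    using J(2) that by (simp add: set_eq_iff del: mem_Collect_eq) blast
  have J_sub: "J \<subseteq> carrier ?R'"
    using J(1) unfolding is_left_ideal_def additive_subgroup_def subgroup_def by auto
  have J_mult: "a \<otimes> x \<in> J" if "a \<in> carrier ?R'" "x \<in> J" for a x
    using J(1) that by (auto simp: is_left_ideal_def)
  have "\<one> \<in> ?I <+>\<^bsub>?R'\<^esub> J"
    using R'.one_closed by (simp add: J(3))
  then obtain r j where j: "j \<in> J" "\<one> = ?ev (p * r) \<oplus> j"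
    by (auto simp: set_add_def set_mult_def)
  obtain s where s: "j = ?ev s" using j J_sub by (auto simp: A)
  have "?ev (p * r * s) \<in> J"
    using J_mult[of "?ev (p * r)" j] j(1) u
    by (simp add: A s poly_eval_mult[OF u, of "p * r"] del: poly_eval_mult)
  then have prs: "?ev (p * r * s) = \<zero>"
    by (intro I_J range_eqI[of _ _ "r * s"]) (simp_all only: mult.assoc)
  have "?ev (p * r) = ?ev (p * r) \<otimes> \<one>" using u by simp
  also have "\<dots> = ?ev (p * r * (p * r) + p * r * s)"
    unfolding j(2) s using u by (simp add: r_distr)
  also have "p * r * (p * r) = (p * p) * (r * r)" by (simp add: mult_ac)
  finally have "?ev (p * r) = \<zero>"
    using u prs p2 by (simp del: poly_eval_mult add: poly_eval_mult[OF u, of "p * p"])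
  then have "j = \<one>" using j u s by simp
  with J_mult[of "?ev p" j] j(1) u have "?ev p \<in> J" by (simp add: A)
  moreover have "?ev p \<in> ?I" by (rule range_eqI[of _ _ 1]) simp
  ultimately show False using I_J p by blast
qed

section \<open>The annihilating polynomial of the generator\<close>

context Uq_triple
begin

lemma k_pow_f: "k [^] (n::nat) \<otimes> f = inverse (q ^ 2) ^ n \<odot> (f \<otimes> k [^] n)"
proof (induction n)
  case (Suc n)
  have "k [^] Suc n \<otimes> f = k [^] n \<otimes> (k \<otimes> f)" by (simp add: m_assoc)
  also have "\<dots> = inverse (q ^ 2) \<odot> ((k [^] n \<otimes> f) \<otimes> k)" by (simp add: k_f m_assoc)
  finally show ?case by (simp add: Suc m_assoc mult.commute)
qed simp

text \<open>Sorting the product only produces scalars, so (k f)^N is a multiple of f^N k^N. The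
  scalar is left existential, as f^N = 0 kills every multiple.\<close>

lemma kf_pow: "(k \<otimes> f) [^] N = \<zero>"
proof -
  have "\<exists>c. (k \<otimes> f) [^] n = c \<odot> (f [^] n \<otimes> k [^] n)" for n :: nat
  proof (induction n)
    case 0
    show ?case by (rule exI[of _ 1]) simp
  next
    case (Suc n)
    then obtain c where c: "(k \<otimes> f) [^] n = c \<odot> (f [^] n \<otimes> k [^] n)" by auto
    have "(k \<otimes> f) [^] Suc n = c \<odot> (f [^] n \<otimes> ((k [^] Suc n) \<otimes> f))"
      by (simp add: c m_assoc)
    then show ?case unfolding k_pow_f by (auto simp: m_assoc)
  qed
  then obtain c where "(k \<otimes> f) [^] N = c \<odot> (f [^] N \<otimes> k [^] N)" by blast
  then show ?thesis by (simp add: f_pow)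
qed

text \<open>
  If the multiple \<open>2 \<sigma> k\<close> is split evenly between \<open>e\<close> and \<open>a k f\<close>, then the \<open>k\<^sup>2\<close>-terms of the
  \<open>q\<^sup>2\<close>-commutator of the two summands cancel by the hypothesis on \<open>a\<close>, and they form a
  \<open>q\<close>-oscillator pair.
\<close>

lemma q_hermite_annihilates:
  fixes a \<sigma>
  defines "u \<equiv> e \<oplus> a \<odot> (k \<otimes> f) \<oplus> (2 * \<sigma>) \<odot> k"
  assumes N: "0 < N" and prim: "primitive_root_of_unity N (q ^ 2)"
    and a: "a * (1 / (q - inverse q)) = (1 - q ^ 2) * \<sigma> ^ 2"
  shows "poly_eval B u (q_hermite (q ^ 2) (\<sigma> ^ 2) N - [:2 * \<sigma> ^ N:]) = \<zero>"
proof -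
  let ?Q = "q ^ 2" and ?d = "1 / (q - inverse q)"
  let ?Y = "e \<oplus> \<sigma> \<odot> k" and ?Z = "a \<odot> (k \<otimes> f) \<oplus> \<sigma> \<odot> k"
  let ?K' = "k [^] (N - 1)"
  have Q0: "?Q \<noteq> 0"
  proof
    assume "?Q = 0"
    then show False using prim N by (simp add: primitive_root_of_unity_def power_0_left)
  qed
  have K': "?K' \<otimes> k = \<one>" using N k_pow nat_pow_Suc[of k "N - 1"] by simp
  have u: "u = ?Y \<oplus> ?Z"
    unfolding u_def mult_2 smult_l_distr[OF k_closed] by (simp add: a_ac)
  have fe: "(k \<otimes> f) \<otimes> e = f \<otimes> (e \<otimes> k)"
    using Q0 by (simp add: k_f k_e m_assoc)
  \<comment> \<open>Moving \<open>k\<close> to the right end makes the inverse k^(N-1) from the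
    commutator meet \<open>k\<close> and cancel: this is the source of the scalar term in the
    oscillator relation.\<close>
  have ef: "e \<otimes> (k \<otimes> f) = inverse ?Q \<odot> (f \<otimes> (e \<otimes> k) \<oplus> (?d \<odot> (k \<otimes> k) \<oplus> (- ?d) \<odot> \<one>))"
  proof -
    have "e \<otimes> (k \<otimes> f) = inverse ?Q \<odot> ((e \<otimes> f) \<otimes> k)" by (simp add: k_f m_assoc)
    then show ?thesis by (simp add: e_f l_distr K' m_assoc)
  qed
  have kkf: "k \<otimes> (k \<otimes> f) = inverse ?Q \<odot> ((k \<otimes> f) \<otimes> k)"
  proof -
    have "k \<otimes> (k \<otimes> f) = inverse ?Q \<odot> (k \<otimes> (f \<otimes> k))" by (subst k_f) simp
    then show ?thesis by (simp add: m_assoc)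
  qed
  \<comment> \<open>Both Z Y and Y Z are expanded in these four monomials and \<one>.\<close>
  let ?P = "f \<otimes> (e \<otimes> k)" and ?G = "(k \<otimes> f) \<otimes> k" and ?E = "e \<otimes> k" and ?K2 = "k \<otimes> k"
  have ZY: "?Z \<otimes> ?Y = (a \<odot> ?P \<oplus> (a * \<sigma>) \<odot> ?G) \<oplus> ((\<sigma> * ?Q) \<odot> ?E \<oplus> \<sigma> ^ 2 \<odot> ?K2)"
    by (simp add: l_distr r_distr fe k_e smult_r_distr power2_eq_square mult_ac a_ac del: m_assoc)
  have "?Q \<odot> (?Y \<otimes> ?Z) = ?Q \<odot> ((a * inverse ?Q) \<odot> ?P \<oplus> ((a * inverse ?Q * ?d) \<odot> ?K2 \<oplus> (a * inverse ?Q * (- ?d)) \<odot> \<one>)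
      \<oplus> \<sigma> \<odot> ?E \<oplus> ((\<sigma> * a * inverse ?Q) \<odot> ?G \<oplus> \<sigma> ^ 2 \<odot> ?K2))"
    by (simp add: l_distr r_distr ef kkf smult_r_distr power2_eq_square mult_ac a_ac del: m_assoc)
  also have "\<dots> = a \<odot> ?P \<oplus> ((a * ?d) \<odot> ?K2 \<oplus> (- (a * ?d)) \<odot> \<one>)
      \<oplus> (\<sigma> * ?Q) \<odot> ?E \<oplus> ((a * \<sigma>) \<odot> ?G \<oplus> (?Q * \<sigma> ^ 2) \<odot> ?K2)"
  proof -
    have "?Q * (x * inverse ?Q * y) = x * y" "?Q * (x * inverse ?Q) = x" for x y
      using Q0 by (simp_all add: field_simps)
    then show ?thesis
      by (simp only: smult_r_distr smult_smult a_closed m_closed smult_closed k_closed e_closed f_closed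
          one_closed mult_minus_right mult.commute[of ?Q \<sigma>] mult.commute[of \<sigma> a])
  qed
  also have "\<dots> = ((a \<odot> ?P \<oplus> (a * \<sigma>) \<odot> ?G) \<oplus> ((\<sigma> * ?Q) \<odot> ?E \<oplus> ((a * ?d) \<odot> ?K2 \<oplus> (?Q * \<sigma> ^ 2) \<odot> ?K2)))
      \<oplus> (- (a * ?d)) \<odot> \<one>"
    by (simp only: a_ac a_closed m_closed smult_closed k_closed e_closed f_closed one_closed)
  also have "(a * ?d) \<odot> ?K2 \<oplus> (?Q * \<sigma> ^ 2) \<odot> ?K2 = \<sigma> ^ 2 \<odot> ?K2"
    unfolding a by (subst smult_l_distr[symmetric]) (simp_all add: algebra_simps)
  finally have QYZ: "?Q \<odot> (?Y \<otimes> ?Z) = ?Z \<otimes> ?Y \<oplus> (- (a * ?d)) \<odot> \<one>"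
    unfolding ZY .
  have osc: "?Z \<otimes> ?Y = ?Q \<odot> (?Y \<otimes> ?Z) \<oplus> ((1 - ?Q) * \<sigma> ^ 2) \<odot> \<one>"
    unfolding QYZ a by (simp add: smult_minus_left a_assoc l_neg)
  \<comment> \<open>Within \<open>?Y\<close>, and likewise within \<open>?Z\<close>, the summands
    commute up to q^2, so N-th powers are taken termwise. The nilpotent summand disappears and
    (\<sigma> k)^N = \<sigma>^N remains in both cases, whence the constant 2 \<sigma>^N.\<close>
  have "?Y [^] N = e [^] N \<oplus> (\<sigma> \<odot> k) [^] N"
    by (rule q_binomial_theorem_root_of_unity[OF _ _ _ prim]) (simp_all add: k_e mult.commute)
  then have Y: "?Y [^] N = \<sigma> ^ N \<odot> \<one>" by (simp add: e_pow smult_pow k_pow)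
  have "(\<sigma> \<odot> k \<oplus> a \<odot> (k \<otimes> f)) [^] N = (\<sigma> \<odot> k) [^] N \<oplus> (a \<odot> (k \<otimes> f)) [^] N"
  proof (rule q_binomial_theorem_root_of_unity[OF _ _ _ prim])
    have coeff: "?Q * (a * (\<sigma> * inverse ?Q)) = \<sigma> * a" using Q0 by (simp add: field_simps)
    show "(a \<odot> (k \<otimes> f)) \<otimes> (\<sigma> \<odot> k) = ?Q \<odot> ((\<sigma> \<odot> k) \<otimes> (a \<odot> (k \<otimes> f)))"
      by (simp add: kkf coeff)
  qed simp_all
  then have Z: "?Z [^] N = \<sigma> ^ N \<odot> \<one>" by (simp add: kf_pow smult_pow k_pow a_comm)
  have "poly_eval B (?Y \<oplus> ?Z) (q_hermite ?Q (\<sigma> ^ 2) N) = ?Y [^] N \<oplus> ?Z [^] N"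
    by (rule poly_eval_q_hermite_root_of_unity[OF _ _ osc prim]) simp_all
  then have "poly_eval B u (q_hermite ?Q (\<sigma> ^ 2) N) = (2 * \<sigma> ^ N) \<odot> \<one>"
    unfolding u mult_2 smult_l_distr[OF one_closed] Y Z .
  then show ?thesis
    by (simp add: poly_eval_diff u_def smult_minus_left r_neg)
qed

end

section \<open>From the algebra to the Hopf record\<close>

lemma Uq_simps [simp]:
  "carrier (Uq N q) = carrier (Uq_alg N q)" "monoid.mult (Uq N q) = monoid.mult (Uq_alg N q)"
  "one (Uq N q) = one (Uq_alg N q)" "add (Uq N q) = add (Uq_alg N q)"
  "zero (Uq N q) = zero (Uq_alg N q)" "module.smult (Uq N q) = module.smult (Uq_alg N q)"
  "comult (Uq N q) = pres_lift (tensor_algebra (Uq_alg N q) (Uq_alg N q)) (Uq_comult_gen N q)"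
  "counit (Uq N q) = pres_lift scalar_algebra Uq_counit_gen"
  by (simp_all add: Uq_def module.defs hopf.defs)

lemma kalgebra_Uq: "kalgebra (Uq N q)"
proof -
  interpret Uq_triple "Uq_alg N q" N q "K\<^sub>q N q" "E\<^sub>q N q" "F\<^sub>q N q" by (rule Uq_triple_Uq_alg)
  show ?thesis by (rule kalgebra_cong[OF kalgebra_axioms]) simp_all
qed

lemma poly_eval_Uq: "poly_eval (Uq N q) u p = poly_eval (Uq_alg N q) u p"
  by (simp add: poly_eval_def)

text \<open>Subalgebras of the two sides are described over different record types; they are
  compared as ranges of the same evaluation map.\<close>

lemma gen_subalgebra_Uq:
  "u \<in> carrier (Uq_alg N q) \<Longrightarrow> gen_subalgebra (Uq N q) {u} = gen_subalgebra (Uq_alg N q) {u}"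
  using kalgebra.gen_subalgebra_singleton[OF kalgebra_Uq, of u N q]
    kalgebra.gen_subalgebra_singleton[OF Uq_triple.axioms(1)[OF Uq_triple_Uq_alg], of u N q]
  by (simp add: poly_eval_Uq[abs_def])

lemma tensor_subspace_Uq:
  "tensor_subspace (Uq N q) (Uq N q) S S' = tensor_subspace (Uq_alg N q) (Uq_alg N q) S S'"
  by (simp add: tensor_subspace_def tensor_ideal_def bilinear_rels_def DirProd_def)

section \<open>The coideal subalgebra\<close>

text \<open>For 0 < k < N the even number 2k differs from the odd N, so 2k or 2k - N lies strictly
  between 0 and N. Then q^(2k) = 1 would contradict primitivity at that exponent.\<close>

lemma primitive_root_of_unity_square:
  assumes "odd N" and prim: "primitive_root_of_unity N (q :: 'k::field)"
  shows "primitive_root_of_unity N (q ^ 2)"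
proof -
  have N: "0 < N" "q ^ N = 1" using prim by (auto simp: primitive_root_of_unity_def)
  have "(q ^ 2) ^ k \<noteq> 1" if k: "0 < k" "k < N" for k
  proof
    assume "(q ^ 2) ^ k = 1"
    then have 1: "q ^ (2 * k) = 1" by (simp add: power_mult)
    show False
    proof (cases "2 * k < N")
      case True
      with 1 k primitive_root_power_ne_1[OF prim, of "2 * k"] show False by simp
    next
      case False
      have "2 * k \<noteq> N" using assms(1) by auto
      with False k have *: "2 * k = N + (2 * k - N)" "0 < 2 * k - N" "2 * k - N < N" by auto
      then have "q ^ (2 * k - N) = 1" using 1 N(2) by (metis mult_1 power_add)
      with primitive_root_power_ne_1[OF prim *(2,3)] show False by simp
    qed
  qed
  moreover have "(q ^ 2) ^ N = 1" using N by (metis mult.commute power_mult power_one)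
  ultimately show ?thesis using N by (simp add: primitive_root_of_unity_def)
qed

text \<open>The counit kills \<open>E\<close> and K F and sends \<open>K\<close> to 1, so the
  generator goes to b; multiplicativity does the rest.\<close>

lemma counit_poly_eval:
  fixes a b :: "'k::field"
  assumes "0 < N"
  shows "counit (Uq N q) (poly_eval (Uq_alg N q)
      (E\<^sub>q N q \<oplus>\<^bsub>Uq_alg N q\<^esub> a \<odot>\<^bsub>Uq_alg N q\<^esub> (K\<^sub>q N q \<otimes>\<^bsub>Uq_alg N q\<^esub> F\<^sub>q N q)
        \<oplus>\<^bsub>Uq_alg N q\<^esub> b \<odot>\<^bsub>Uq_alg N q\<^esub> K\<^sub>q N q) p) = poly p b"
proof -
  interpret Uq_triple "Uq_alg N q" N q "K\<^sub>q N q" "E\<^sub>q N q" "F\<^sub>q N q" by (rule Uq_triple_Uq_alg)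
  have triple: "Uq_triple scalar_algebra N q (Uq_counit_gen GK :: 'k) (Uq_counit_gen GE) (Uq_counit_gen GF)"
    using Uq_triple_scalar_algebra[OF assms] by (simp add: Uq_counit_gen_def)
  interpret \<epsilon>: kalgebra_hom "Uq_alg N q" scalar_algebra "pres_lift scalar_algebra Uq_counit_gen"
    by (rule kalgebra_hom_Uq_alg[OF triple])
  show ?thesis
    by (induction p) (simp_all add: pres_lift_Uq[OF triple] Uq_counit_gen_def)
qed

theorem proposition6p5:
  fixes q \<alpha> \<beta> :: "'k :: {alg_closed_field, field_char_0}" and N :: nat
  assumes "N > 1" and "odd N" and "primitive_root_of_unity N q"
    and "\<beta> \<noteq> 0" and "4 * \<alpha> = (1 - q ^ 2) * \<beta> ^ 2"
  shows "let U = Uq N q;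
             A = gen_subalgebra U
                   {E\<^sub>q N q \<oplus>\<^bsub>U\<^esub> \<alpha> \<odot>\<^bsub>U\<^esub> Ft\<^sub>q N q \<oplus>\<^bsub>U\<^esub> \<beta> \<odot>\<^bsub>U\<^esub> K\<^sub>q N q}
         in right_coideal_subalgebra U A \<and>
            \<not> semisimple_ring (U\<lparr>carrier := A\<rparr>) \<and>
            (\<exists>\<Lambda>. is_total_integral U A \<Lambda>)"
proof -
  let ?U = "Uq_alg N q" and ?H = "Uq N q"
  interpret U: Uq_triple ?U N q "K\<^sub>q N q" "E\<^sub>q N q" "F\<^sub>q N q" by (rule Uq_triple_Uq_alg)
  interpret H: kalgebra ?H by (rule kalgebra_Uq)
  obtain m where m: "N = 2 * m + 1" using \<open>odd N\<close> by (auto elim: oddE)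
  with \<open>N > 1\<close> have m_pos: "0 < m" by simp
  have prim: "primitive_root_of_unity N (q ^ 2)"
    by (rule primitive_root_of_unity_square) fact+
  have Q: "q ^ 2 \<noteq> 1" by (rule Q_neq_1[OF \<open>N > 1\<close> prim])
  have q0: "q \<noteq> 0" by (rule q_neq_0[OF \<open>N > 1\<close> prim])
  have d: "q - inverse q \<noteq> 0"
    using Q q0 by (simp add: field_simps power2_eq_square)
  define \<sigma> where "\<sigma> = \<beta> / 2"
  have \<sigma>: "\<sigma> \<noteq> 0" "\<beta> = 2 * \<sigma>" using \<open>\<beta> \<noteq> 0\<close> by (simp_all add: \<sigma>_def)
  have "4 * \<alpha> = 4 * ((1 - q ^ 2) * \<sigma> ^ 2)" using assms(5) by (simp add: \<sigma>(2) power2_eq_square)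
  then have \<alpha>: "\<alpha> = (1 - q ^ 2) * \<sigma> ^ 2" by simp
  \<comment> \<open>\<open>a\<close> absorbs the factor q - q^-1 contained in
    \<open>Ft\<^sub>q\<close>. Dividing by that factor returns \<alpha>, which the hypothesis
    identifies with (1 - q^2) \<sigma>^2.\<close>
  define a where "a = \<alpha> * (q - inverse q)"
  have a: "a \<noteq> 0" "a * (1 / (q - inverse q)) = (1 - q ^ 2) * \<sigma> ^ 2"
    using d Q \<sigma> \<alpha> by (simp_all add: a_def)
  define u where "u = E\<^sub>q N q \<oplus>\<^bsub>?U\<^esub> a \<odot>\<^bsub>?U\<^esub> (K\<^sub>q N q \<otimes>\<^bsub>?U\<^esub> F\<^sub>q N q) \<oplus>\<^bsub>?U\<^esub> (2 * \<sigma>) \<odot>\<^bsub>?U\<^esub> K\<^sub>q N q"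
  have u: "u \<in> carrier ?U" by (simp add: u_def)
  have u_eq: "E\<^sub>q N q \<oplus>\<^bsub>?H\<^esub> \<alpha> \<odot>\<^bsub>?H\<^esub> Ft\<^sub>q N q \<oplus>\<^bsub>?H\<^esub> \<beta> \<odot>\<^bsub>?H\<^esub> K\<^sub>q N q = u"
    by (simp add: u_def Ft\<^sub>q_def a_def \<sigma>(2))
  let ?A = "gen_subalgebra ?U {u}" and ?ev = "poly_eval ?U u"
  note A = U.gen_subalgebra_singleton[OF u]
  have A_H: "gen_subalgebra ?H {u} = ?A" by (rule gen_subalgebra_Uq[OF u])
  define W where "W = chebyshev_W \<sigma> m"
  have W_\<beta>: "poly W (2 * \<sigma>) \<noteq> 0"
  proof -
    have "poly W (2 * \<sigma>) = \<sigma> ^ m * of_nat N"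
      unfolding W_def poly_chebyshev_W_double m ..
    then show ?thesis using \<sigma> \<open>N > 1\<close> by simp
  qed
  have ann: "?ev ([:- (2 * \<sigma>), 1:] * W ^ 2) = \<zero>\<^bsub>?U\<^esub>"
    unfolding W_def q_hermite_factorization[OF prim m \<sigma>(1), symmetric] u_def
    using \<open>N > 1\<close> by (intro U.q_hermite_annihilates[OF _ prim a(2)]) simp

  have "is_subalgebra ?H ?A"
    using H.subalgebra_range_poly_eval[of u] u by (simp add: A poly_eval_Uq[abs_def])
  moreover have "comult ?H ` ?A \<subseteq> tensor_subspace ?H ?H ?A (carrier ?H)"
    using comult_in_tensor_subspace[OF _ prim, of _ a "2 * \<sigma>"] \<open>N > 1\<close>
    by (auto simp: tensor_subspace_Uq u_def)
  ultimately have coideal: "right_coideal_subalgebra ?H ?A"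
    by (simp add: right_coideal_subalgebra_def)

  have "\<not> semisimple_ring (?H\<lparr>carrier := gen_subalgebra ?H {u}\<rparr>)"
  proof (rule H.not_semisimple_gen_subalgebra)
    let ?p = "[:- (2 * \<sigma>), 1:] * W"
    show "u \<in> carrier ?H" using u by simp
    have "W \<noteq> 0" using W_\<beta> by auto
    moreover have "degree ?p \<le> Suc m"
      using degree_mult_le[of "[:- (2 * \<sigma>), 1:]" W] degree_chebyshev_W[of \<sigma> m]
      by (simp add: W_def del: mult_pCons_left)
    \<comment> \<open>The degree is at most m + 1, which is below N = 2m + 1 because m > 0.\<close>
    ultimately have "?ev ?p \<noteq> \<zero>\<^bsub>?U\<^esub>"
      unfolding u_def using m m_pos
      by (intro poly_eval_Uq_neq_0[OF \<open>N > 1\<close> prim a(1)]) (simp_all del: mult_pCons_left)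
    then show "poly_eval ?H u ?p \<noteq> \<zero>\<^bsub>?H\<^esub>"
      by (simp add: poly_eval_Uq del: mult_pCons_left)
    have "?p * ?p = ([:- (2 * \<sigma>), 1:] * W ^ 2) * [:- (2 * \<sigma>), 1:]"
      by (simp only: power2_eq_square mult_ac)
    then show "poly_eval ?H u (?p * ?p) = \<zero>\<^bsub>?H\<^esub>"
      unfolding poly_eval_Uq using ann u by (simp only: U.poly_eval_mult[OF u, of "_ * W ^ 2"]) simp
  qed
  then have not_semisimple: "\<not> semisimple_ring (?H\<lparr>carrier := ?A\<rparr>)" unfolding A_H .

  have counit: "counit ?H (?ev p) = poly p (2 * \<sigma>)" for p
    unfolding u_def using \<open>N > 1\<close> by (intro counit_poly_eval) simp
  have "is_total_integral ?H ?A (?ev (W ^ 2))"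
    unfolding is_total_integral_def
  proof (intro conjI ballI)
    show "?ev (W ^ 2) \<in> ?A" by (simp only: A rangeI)
    show "counit ?H (?ev (W ^ 2)) \<noteq> 0" unfolding counit using W_\<beta> by simp
  next
    fix x assume "x \<in> ?A"
    then obtain p where p: "x = ?ev p" by (auto simp: A)
    \<comment> \<open>Division by x - \<beta> leaves the remainder p(\<beta>), which is the counit
      of p(u). The other part is killed by W(u)^2, since (x - \<beta>) W^2 annihilates
      \<open>u\<close>.\<close>
    let ?r = "synthetic_div p (2 * \<sigma>)"
    have "W ^ 2 * p = W ^ 2 * ([:- (2 * \<sigma>), 1:] * ?r + [:poly p (2 * \<sigma>):])"
      by (simp only: synthetic_div_correct')
    also have "\<dots> = ([:- (2 * \<sigma>), 1:] * W ^ 2) * ?r + Polynomial.smult (poly p (2 * \<sigma>)) (W ^ 2)"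
      by (simp add: algebra_simps)
    finally have "W ^ 2 * p = \<dots>" .
    then have "?ev (W ^ 2 * p) = poly p (2 * \<sigma>) \<odot>\<^bsub>?U\<^esub> ?ev (W ^ 2)"
      using u ann U.poly_eval_mult[OF u, of "[:- (2 * \<sigma>), 1:] * W ^ 2" ?r]
      by (simp only: U.poly_eval_add U.poly_eval_smult) simp
    then show "?ev (W ^ 2) \<otimes>\<^bsub>?H\<^esub> x = counit ?H x \<odot>\<^bsub>?H\<^esub> ?ev (W ^ 2)"
      unfolding p counit using U.poly_eval_mult[OF u, of "W ^ 2" p] by simp
  qed
  with coideal not_semisimple show ?thesis
    unfolding Let_def u_eq A_H by blast
qed

end
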